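(* Suppose $E\subset\mathbb{R}$ is a middle interval Cantor set. (i) If $E$ is uniformly perfect, then $E$ is minimal for conformal dimension if and only if $\dim_H E=1$. (ii) If $\dim_H E=1$, then $\dim_H f(E)\ge 1$ whenever $f$ is a map on $E$ that extends to a quasisymmetric map of a uniformly perfect space (that is, there is a uniformly perfect metric space $X$ containing $E$ as a metric subspace and a quasisymmetric map $F$ of $X$ into a metric space with $F|_E=f$).
   Context: Middle interval Cantor sets: given a sequence $\{c_i\}$ with $0\le c_i<1$, start from the unit interval on the line and remove its open middle part of relative length $c_1$ to obtain two intervals of equal length. Inductively, in the $i$-th step remove from every remaining (closed) interval of the previous step its open middle part of relative length $c_i$, to obtain $2^i$ intervals of equal length. The set $E$ of points that are never removed is the middle interval Cantor set corresponding to $\{c_i\}$. A metric space $X$ is uniformly perfect if there is a constant $C\ge1$ so that for each $x\in X$ and all $r>0$, $X\setminus B(x,r)\ne\emptyset$ implies $B(x,r)\setminus B(x,r/C)\neq\emptyset$, where $B(x,r)$ is the open ball. Given a homeomorphism $\eta:[0,\infty)\to[0,\infty)$, an embedding $f$ (a homeomorphism onto its image) from a metric space $(X,d_X)$ into a metric space $(Y,d_Y)$ is $\eta$-quasisymmetric if for all distinct triples $x,y,z\in X$ and all $t>0$, $\frac{d_X(x,y)}{d_X(y,z)}\le t$ implies $\frac{d_Y(f(x),f(y))}{d_Y(f(y),f(z))}\le \eta(t)$; it is quasisymmetric if this holds for some $\eta$. The conformal dimension of $X$ is the infimum of $\dim_H f(X)$ (Hausdorff dimension) over all quasisymmetric maps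 $f$ defined on $X$ with values in arbitrary metric spaces. $X$ is minimal for conformal dimension if its conformal dimension equals $\dim_H X$. *)

theory Defs
  imports "HOL-Analysis.Analysis"
begin

primrec Cantor_intervals :: "(nat \<Rightarrow> real) \<Rightarrow> nat \<Rightarrow> (real \<times> real) set" where
  "Cantor_intervals c 0 = {(0, 1)}"
| "Cantor_intervals c (Suc n) =
     (\<Union>(a, b) \<in> Cantor_intervals c n.
        {(a, (a + b) / 2 - c (Suc n) * (b - a) / 2),
         ((a + b) / 2 + c (Suc n) * (b - a) / 2, b)})"

(* The sequence is indexed from 1, as is the construction; c 0 is irrelevant.  For c i = 0 the
   removed open interval is empty and the two new intervals share an endpoint. *)
definition middle_interval_Cantor_set :: "real set \<Rightarrow> bool" where
  "middle_interval_Cantor_set E \<longleftrightarrow>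
     (\<exists>c. (\<forall>i\<ge>1. 0 \<le> c i \<and> c i < 1) \<and>
          E = (\<Inter>n. \<Union>(a, b) \<in> Cantor_intervals c n. {a..b}))"

definition uniformly_perfect :: "'a metric \<Rightarrow> bool" where
  "uniformly_perfect X \<longleftrightarrow>
     (\<exists>C::real. C \<ge> 1 \<and>
        (\<forall>x\<in>mspace X. \<forall>r>0. mspace X - mball_of X x r \<noteq> {} \<longrightarrow>
            mball_of X x r - mball_of X x (r / C) \<noteq> {}))"

definition eta_quasisymmetric ::
    "(real \<Rightarrow> real) \<Rightarrow> 'a metric \<Rightarrow> 'b metric \<Rightarrow> ('a \<Rightarrow> 'b) \<Rightarrow> bool" where
  "eta_quasisymmetric \<eta> X Y f \<longleftrightarrow>
     embedding_map (mtopology_of X) (mtopology_of Y) f \<and>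
     (\<forall>x\<in>mspace X. \<forall>y\<in>mspace X. \<forall>z\<in>mspace X. \<forall>t>0.
        x \<noteq> y \<and> y \<noteq> z \<and> x \<noteq> z \<and> mdist X x y / mdist X y z \<le> t \<longrightarrow>
        mdist Y (f x) (f y) / mdist Y (f y) (f z) \<le> \<eta> t)"

definition quasisymmetric :: "'a metric \<Rightarrow> 'b metric \<Rightarrow> ('a \<Rightarrow> 'b) \<Rightarrow> bool" where
  "quasisymmetric X Y f \<longleftrightarrow>
     (\<exists>\<eta>. (\<exists>\<theta>. homeomorphism {0..} {0..} \<eta> \<theta>) \<and> eta_quasisymmetric \<eta> X Y f)"

definition isometric_embedding :: "'a metric \<Rightarrow> 'b metric \<Rightarrow> ('a \<Rightarrow> 'b) \<Rightarrow> bool" where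
  "isometric_embedding X Y f \<longleftrightarrow>
     f \<in> mspace X \<rightarrow> mspace Y \<and>
     (\<forall>x\<in>mspace X. \<forall>y\<in>mspace X. mdist Y (f x) (f y) = mdist X x y)"

definition mdiam :: "'a metric \<Rightarrow> 'a set \<Rightarrow> ennreal" where
  "mdiam X U = (SUP x\<in>U. SUP y\<in>U. ennreal (mdist X x y))"

definition Hausdorff_content :: "'a metric \<Rightarrow> real \<Rightarrow> real \<Rightarrow> ennreal" where
  "Hausdorff_content X s \<delta> =
     (INF U \<in> {U :: nat \<Rightarrow> 'a set.
                 (\<forall>i. U i \<subseteq> mspace X \<and> mdiam X (U i) \<le> ennreal \<delta>) \<and> mspace X \<subseteq> (\<Union>i. U i)}.
        \<Sum>i. ennreal (enn2real (mdiam X (U i)) powr s))"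

(* Total mass of the space.  Meant for s > 0 only: since 0 powr 0 = 0, the case s = 0
   is not counting measure. *)
definition Hausdorff_measure :: "'a metric \<Rightarrow> real \<Rightarrow> ennreal" where
  "Hausdorff_measure X s = (SUP \<delta>\<in>{0<..}. Hausdorff_content X s \<delta>)"

definition Hausdorff_dim :: "'a metric \<Rightarrow> ennreal" where
  "Hausdorff_dim X = (INF s \<in> {s. s > 0 \<and> Hausdorff_measure X s = 0}. ennreal s)"

(* The image of X under an embedding is in bijection with the carrier of X, so metric spaces
   over the type of X suffice as targets; conformal_dim_le_Hausdorff_dim below confirms that
   targets over any other type are covered by this infimum. *)
definition conformal_dim :: "'a metric \<Rightarrow> ennreal" where
  "conformal_dim X =
     (INF (Y, f) \<in> {(Y :: 'a metric, f :: 'a \<Rightarrow> 'a). quasisymmetric X Y f}.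
        Hausdorff_dim (submetric Y (f ` mspace X)))"

definition conformally_minimal :: "'a metric \<Rightarrow> bool" where
  "conformally_minimal X \<longleftrightarrow> conformal_dim X = Hausdorff_dim X"

lemma mdiam_isometry:
  assumes "\<And>x y. x \<in> U \<Longrightarrow> y \<in> U \<Longrightarrow> mdist Y (f x) (f y) = mdist X x y"
  shows "mdiam Y (f ` U) = mdiam X U"
  unfolding mdiam_def image_image using assms by (auto intro!: SUP_cong)

lemma Hausdorff_content_isometry_le:
  assumes iso: "\<And>x y. x \<in> mspace X \<Longrightarrow> y \<in> mspace X \<Longrightarrow> mdist Y (f x) (f y) = mdist X x y"
    and onto: "f ` mspace X = mspace Y"
  shows "Hausdorff_content Y s \<delta> \<le> Hausdorff_content X s \<delta>"
  unfolding Hausdorff_content_def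
proof (rule INF_greatest)
  fix U :: "nat \<Rightarrow> 'a set"
  assume U: "U \<in> {U. (\<forall>i. U i \<subseteq> mspace X \<and> mdiam X (U i) \<le> ennreal \<delta>) \<and> mspace X \<subseteq> (\<Union>i. U i)}"
  have eq: "mdiam Y (f ` U i) = mdiam X (U i)" for i
    using U by (intro mdiam_isometry iso) auto
  have sub: "f ` U i \<subseteq> mspace Y" for i
    using U onto[symmetric] by (simp add: image_mono)
  have "f ` mspace X \<subseteq> f ` (\<Union>i. U i)"
    using U by (intro image_mono) simp
  then have cover: "mspace Y \<subseteq> (\<Union>i. f ` U i)"
    by (simp only: onto image_UN)
  have mem: "(\<lambda>i. f ` U i) \<in> {V. (\<forall>i. V i \<subseteq> mspace Y \<and> mdiam Y (V i) \<le> ennreal \<delta>) \<and>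
                               mspace Y \<subseteq> (\<Union>i. V i)}"
    using U sub cover by (simp add: eq)
  show "(INF V \<in> {V. (\<forall>i. V i \<subseteq> mspace Y \<and> mdiam Y (V i) \<le> ennreal \<delta>) \<and>
                     mspace Y \<subseteq> (\<Union>i. V i)}.
        \<Sum>i. ennreal (enn2real (mdiam Y (V i)) powr s))
      \<le> (\<Sum>i. ennreal (enn2real (mdiam X (U i)) powr s))"
    by (rule INF_lower2[OF mem]) (simp add: eq)
qed

lemma Hausdorff_dim_isometry_le:
  assumes "\<And>x y. x \<in> mspace X \<Longrightarrow> y \<in> mspace X \<Longrightarrow> mdist Y (f x) (f y) = mdist X x y"
    and "f ` mspace X = mspace Y"
  shows "Hausdorff_dim Y \<le> Hausdorff_dim X"
proof -
  have "Hausdorff_measure Y s \<le> Hausdorff_measure X s" for s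
    unfolding Hausdorff_measure_def
    by (intro SUP_mono') (rule Hausdorff_content_isometry_le[OF assms])
  then have "Hausdorff_measure X s = 0 \<Longrightarrow> Hausdorff_measure Y s = 0" for s
    by (metis le_zero_eq)
  then show ?thesis
    unfolding Hausdorff_dim_def by (intro INF_superset_mono) auto
qed

lemma conformal_dim_le_Hausdorff_dim:
  fixes X :: "'a metric" and Y :: "'b metric"
  assumes qs: "quasisymmetric X Y f"
  shows "conformal_dim X \<le> Hausdorff_dim (submetric Y (f ` mspace X))"
proof -
  define M where "M = mspace X"
  define Z where "Z = metric (M, \<lambda>x y. mdist Y (f x) (f y))"
  from qs obtain \<eta> \<theta> where eta: "homeomorphism {0..} {0..} \<eta> \<theta>" "eta_quasisymmetric \<eta> X Y f"
    unfolding quasisymmetric_def by blast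
  then have emb: "embedding_map (mtopology_of X) (mtopology_of Y) f"
    by (simp add: eta_quasisymmetric_def)
  then have hom: "homeomorphic_map (mtopology_of X) (subtopology (mtopology_of Y) (f ` M)) f"
    by (simp add: embedding_map_def M_def)
  have inj: "inj_on f M"
    using homeomorphic_imp_injective_map[OF hom] by (simp add: M_def)
  have fM: "f ` M \<subseteq> mspace Y"
    using homeomorphic_imp_surjective_map[OF hom] unfolding topspace_subtopology topspace_mtopology_of M_def[symmetric]
    by blast
  have fin: "f x \<in> mspace Y" if "x \<in> M" for x
    using fM that by blast
  have "Metric_space M (\<lambda>x y. mdist Y (f x) (f y))"
  proof
    fix x y z
    assume xyz: "x \<in> M" "y \<in> M"
    then show "mdist Y (f x) (f y) = 0 \<longleftrightarrow> x = y"
      using fin inj_on_eq_iff[OF inj] by simp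
    assume "z \<in> M"
    with xyz show "mdist Y (f x) (f z) \<le> mdist Y (f x) (f y) + mdist Y (f y) (f z)"
      using fin by (simp add: mdist_triangle)
  next
    fix x y
    show "0 \<le> mdist Y (f x) (f y)" by simp
    show "mdist Y (f x) (f y) = mdist Y (f y) (f x)" by (rule mdist_commute)
  qed
  then have Z: "mspace Z = M" "mdist Z = (\<lambda>x y. mdist Y (f x) (f y))"
    by (simp_all add: Z_def Metric_space.mspace_metric Metric_space.mdist_metric)
  define S where "S = submetric Y (f ` M)"
  have S: "mspace S = f ` M" "mdist S = mdist Y"
    using fM by (auto simp: S_def)
  have topS: "mtopology_of S = subtopology (mtopology_of Y) (f ` M)"
    by (simp add: S_def mtopology_of_submetric)
  define g where "g = inv_into M f"
  have "Lipschitz_continuous_map Z S f"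
    unfolding Lipschitz_continuous_map_def Z S by (intro conjI exI[of _ 1]) auto
  moreover have "Lipschitz_continuous_map S Z g"
    unfolding Lipschitz_continuous_map_def Z S g_def
    by (intro conjI exI[of _ 1]) (auto simp: f_inv_into_f inv_into_into)
  ultimately have "homeomorphic_maps (mtopology_of S) (mtopology_of Z) g f"
    using inj unfolding homeomorphic_maps_def
    by (auto simp: Z S g_def f_inv_into_f Lipschitz_continuous_imp_continuous_map)
  then have "homeomorphic_map (mtopology_of S) (mtopology_of Z) g"
    by (rule homeomorphic_maps_imp_map)
  with hom have "homeomorphic_map (mtopology_of X) (mtopology_of Z) (g \<circ> f)"
    unfolding topS by (rule homeomorphic_map_compose)
  then have idmap: "homeomorphic_map (mtopology_of X) (mtopology_of Z) id"
    by (rule homeomorphic_map_eq) (use inj in \<open>simp add: g_def M_def\<close>)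
  then have idemb: "embedding_map (mtopology_of X) (mtopology_of Z) id"
    unfolding embedding_map_def image_id topspace_mtopology_of
    by (metis M_def Z(1) id_apply subtopology_topspace topspace_mtopology_of)
  have "eta_quasisymmetric \<eta> X Z id"
    using idemb eta(2) unfolding eta_quasisymmetric_def Z id_apply by blast
  then have "quasisymmetric X Z id"
    using eta(1) unfolding quasisymmetric_def by blast
  then have "conformal_dim X \<le> Hausdorff_dim (submetric Z (id ` mspace X))"
    unfolding conformal_dim_def by (intro INF_lower2[of "(Z, id)"]) auto
  also have "\<dots> = Hausdorff_dim Z"
    using submetric_mspace[of Z] Z(1) by (simp add: M_def)
  also have "\<dots> \<le> Hausdorff_dim (submetric Y (f ` mspace X))"
  proof (rule Hausdorff_dim_isometry_le[where f = "inv_into M f"])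
    fix x y assume "x \<in> mspace (submetric Y (f ` mspace X))" "y \<in> mspace (submetric Y (f ` mspace X))"
    then show "mdist Z (inv_into M f x) (inv_into M f y) = mdist (submetric Y (f ` mspace X)) x y"
      by (auto simp: Z M_def f_inv_into_f)
  next
    have "f ` mspace X \<inter> mspace Y = f ` M" using fM by (auto simp: M_def)
    then show "inv_into M f ` mspace (submetric Y (f ` mspace X)) = mspace Z"
      using inj by (simp add: Z)
  qed
  finally show ?thesis .
qed

end

theory Submission
  imports Defs
begin

text \<open>
  Everything about a middle interval Cantor set E is read off from the length L n of the 2^n
  intervals of its n-th step. A point of E is coded by the sequence of left/right choices that lead
  to it, a finite binary word names an interval, and gap n = L n - 2 L (n+1) is the length of the
  interval removed from an interval of length L n.

  \<^bold>\<open>Dimension.\<close> The s-dimensional Hausdorff measure of E vanishes iff the numbers 2^n (L n)^s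
  come arbitrarily close to 0. One direction uses the covering by the intervals of one step
  (\<open>Hausdorff_measure_eq_0\<close>). For the other, and for quasisymmetric images of E as well, it suffices to have a weight
  m on words with m(w) \<le> m(w0) + m(w1) that is dominated by the s-th power of the distance
  between the images of the two endpoints of the interval w (\<open>root_le_sum_of_bar\<close>,
  \<open>Hausdorff_measure_neq_0\<close>). Subadditivity replaces the additivity of a mass distribution, so
  that no measure has to be constructed.

  \<^bold>\<open>Part (ii).\<close> Let f be the quasisymmetric map and \<rho>(w) the distance between the images of
  the endpoints of w. The triangle inequality across the gap bounds \<rho>(w) by \<rho>(w0) + \<rho>(w1) plus the
  distance across the gap. By quasisymmetry that distance is a small multiple of \<rho>(w0) when the gap
  is relatively small; when it is not, uniform perfectness of the big space still gives a polynomial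
  bound. Both cases are contained in \<open>quasisymmetric_sum_bound\<close>, which yields
  \<rho>(w) \<le> e^\<epsilon> (P n / P (n+1))^(2K) (\<rho>(w0) + \<rho>(w1)), where P n = 2^n L n is the total length of the n-th
  step. Hence \<rho>(w) e^(\<epsilon> n) (P n)^(-2K) is subadditive. Dimension 1 means that P n decays
  subexponentially, so this weight is at most a constant times \<rho>(w) e^(2 \<epsilon> n). Finally, \<rho>(w) is
  exponentially small in n, again by uniform perfectness (\<open>quasisymmetric_decay\<close>), so that for s < 1
  a small \<epsilon> makes the weight at most a constant times \<rho>(w)^s. Thus the image has positive
  s-dimensional measure for every s < 1.

  \<^bold>\<open>Part (i).\<close> If the dimension is 1, minimality is part (ii) for X = E. If it is less than 1, then
  for arbitrarily large n a definite proportion of the first n steps removes gaps of relative length at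
  least some \<delta>. Let \<phi>(t) = t 2^(-N(t)), where N(t) counts these steps at scales above t, and replace
  every gap g of E by a gap of length \<phi>(g). The sets are compared through their common coding,
  and the correspondence changes a distance t into one comparable to \<phi>(t) (\<open>image_distance\<close>). It is
  therefore quasisymmetric, and the many factors 1/2 divide the dimension by at least some
  1 + \<beta> > 1. Uniform perfectness of E bounds L (n+1) / L n from below; it makes the comparison work
  and makes the dimension of E positive, so that dividing it by 1 + \<beta> lowers it
  (\<open>conformal_dim_less\<close>).
\<close>

section \<open>Binary coding of middle interval Cantor sets\<close>

text \<open>
  Two non-overlapping intervals of length L (n+1) fit into an interval of length L n: this is all that is
  kept of a middle interval construction. The same abstraction serves for E and for the Cantor set
  onto which E is mapped in the last part.
\<close>
locale halving_sequence =
  fixes L :: "nat \<Rightarrow> real"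
  assumes pos: "0 < L n" and half: "2 * L (Suc n) \<le> L n"
begin

lemma power2_mult_le: "2 ^ k * L (n + k) \<le> L n"
proof (induction k)
  case (Suc k)
  have "2 ^ k * (2 * L (Suc (n + k))) \<le> 2 ^ k * L (n + k)"
    by (intro mult_left_mono half) simp
  also have "2 ^ k * (2 * L (Suc (n + k))) = 2 ^ Suc k * L (n + Suc k)" by simp
  finally show ?case using Suc by linarith
qed simp

lemma less_Suc: "L (Suc n) < L n"
  using half[of n] pos[of "Suc n"] by linarith

lemma antimono: "m \<le> n \<Longrightarrow> L n \<le> L m"
  by (rule lift_Suc_antimono_le[of L]) (auto intro: less_imp_le less_Suc)

lemma strict_antimono: "m < n \<Longrightarrow> L n < L m"
  using antimono[of "Suc m" n] less_Suc[of m] by simp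

lemma less_iff: "L n < L m \<longleftrightarrow> m < n"
  using antimono[of n m] strict_antimono[of m n] by (meson leD leI)

lemma le_iff: "L n \<le> L m \<longleftrightarrow> m \<le> n"
  using less_iff[of m n] by auto

lemma L_le: "L n \<le> L 0 / 2 ^ n"
  using power2_mult_le[of n 0] by (simp add: field_simps)

lemma tendsto_0: "L \<longlonglongrightarrow> 0"
proof (rule tendsto_sandwich[of "\<lambda>_. 0" L _ "\<lambda>n. L 0 / 2 ^ n"])
  show "(\<lambda>n. L 0 / 2 ^ n) \<longlonglongrightarrow> 0"
    using tendsto_mult_right_zero[OF LIMSEQ_power_zero[of "1/2::real"], of "L 0"]
    by (simp add: power_divide)
qed (auto intro: always_eventually less_imp_le pos L_le)

lemma ex_less: "0 < e \<Longrightarrow> \<exists>n. L n < e"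
  using order_tendstoD(2)[OF tendsto_0] by (auto simp: eventually_sequentially)

lemma step_sums: "(\<lambda>k. L (k + n) - L (Suc k + n)) sums L n"
  using telescope_sums'[of "\<lambda>k. L (k + n)" 0] tendsto_0
  by (simp add: LIMSEQ_ignore_initial_segment)

lemma step_pos: "0 < L k - L (Suc k)"
  using less_Suc by simp

text \<open>Choosing the right interval in step k moves the left endpoint by L k - L (k+1).\<close>
definition point :: "(nat \<Rightarrow> bool) \<Rightarrow> real" where
  "point \<sigma> = (\<Sum>k. of_bool (\<sigma> k) * (L k - L (Suc k)))"

definition gap :: "nat \<Rightarrow> real" where
  "gap n = L n - 2 * L (Suc n)"

lemma gap_nonneg: "0 \<le> gap n"
  using half by (simp add: gap_def)

lemma weighted_summable:
  fixes e :: "nat \<Rightarrow> real"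
  assumes "\<And>k. 0 \<le> e k" "\<And>k. e k \<le> M"
  shows "summable (\<lambda>k. e k * (L (k + n) - L (Suc k + n)))"
proof (rule summable_comparison_test')
  show "summable (\<lambda>k. M * (L (k + n) - L (Suc k + n)))"
    using step_sums sums_summable by (intro summable_mult) blast
  show "norm (e k * (L (k + n) - L (Suc k + n))) \<le> M * (L (k + n) - L (Suc k + n))" for k
    using assms[of k] step_pos[of "k + n"] by (simp add: abs_mult mult_right_mono)
qed

lemma weighted_le:
  fixes e :: "nat \<Rightarrow> real"
  assumes "\<And>k. 0 \<le> e k" "\<And>k. e k \<le> M"
  shows "(\<Sum>k. e k * (L (k + n) - L (Suc k + n))) \<le> M * L n"
proof -
  have "(\<Sum>k. e k * (L (k + n) - L (Suc k + n))) \<le> (\<Sum>k. M * (L (k + n) - L (Suc k + n)))"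
    using step_sums[of n] assms step_pos weighted_summable[of e M n]
    by (intro suminf_le mult_right_mono summable_mult sums_summable[OF step_sums]) (auto intro: less_imp_le)
  also have "\<dots> = M * L n"
    using step_sums[of n] by (simp add: suminf_mult sums_iff)
  finally show ?thesis .
qed

lemma weighted_nonneg:
  fixes e :: "nat \<Rightarrow> real"
  assumes "\<And>k. 0 \<le> e k" "\<And>k. e k \<le> M"
  shows "0 \<le> (\<Sum>k. e k * (L (k + n) - L (Suc k + n)))"
  using assms step_pos weighted_summable[OF assms]
  by (intro suminf_nonneg mult_nonneg_nonneg) (auto intro: less_imp_le)

text \<open>
  The distance between two points is the gap that separates them, plus what lies to the right of
  \<sigma> in the left interval, plus what lies to the left of \<tau> in the right one. All coefficients are
  0, 1 or 2 and depend on the codes only, so that distances for the same codes in two different Cantor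
  sets can be compared term by term.
\<close>
lemma point_diff:
  assumes "\<And>i. i < n \<Longrightarrow> \<sigma> i = \<tau> i" and "\<not> \<sigma> n" "\<tau> n"
  shows "point \<tau> - point \<sigma> = gap n +
    (\<Sum>k. (of_bool (\<not> \<sigma> (k + Suc n)) + of_bool (\<tau> (k + Suc n))) * (L (k + Suc n) - L (Suc k + Suc n)))"
proof -
  let ?d = "\<lambda>k. L k - L (Suc k)"
  have s: "summable (\<lambda>k. of_bool (\<rho> k) * ?d k)" for \<rho>
    using weighted_summable[of "\<lambda>k. of_bool (\<rho> k)" 1 0] by simp
  have s': "summable (\<lambda>k. of_bool (\<rho> (k + Suc n)) * ?d (k + Suc n))" for \<rho>
    using weighted_summable[of "\<lambda>k. of_bool (\<rho> (k + Suc n))" 1 "Suc n"] by simp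
  have split: "point \<rho> = (\<Sum>k<n. of_bool (\<rho> k) * ?d k) + of_bool (\<rho> n) * ?d n +
      (\<Sum>k. of_bool (\<rho> (k + Suc n)) * ?d (k + Suc n))" for \<rho>
    unfolding point_def
    by (subst suminf_split_initial_segment[OF s, of _ "Suc n"]) simp
  have "(\<Sum>k. (of_bool (\<not> \<sigma> (k + Suc n)) + of_bool (\<tau> (k + Suc n))) * ?d (k + Suc n)) =
      (\<Sum>k. ?d (k + Suc n) - of_bool (\<sigma> (k + Suc n)) * ?d (k + Suc n) +
          of_bool (\<tau> (k + Suc n)) * ?d (k + Suc n))"
    by (intro suminf_cong) (auto simp: of_bool_def algebra_simps)
  also have "\<dots> = L (Suc n) - (\<Sum>k. of_bool (\<sigma> (k + Suc n)) * ?d (k + Suc n)) +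
      (\<Sum>k. of_bool (\<tau> (k + Suc n)) * ?d (k + Suc n))"
    using step_sums[of "Suc n"] summable_sums[OF s'[of \<sigma>]] summable_sums[OF s'[of \<tau>]]
    by (intro sums_unique[symmetric] sums_add sums_diff) simp_all
  finally have eq: "(\<Sum>k. (of_bool (\<not> \<sigma> (k + Suc n)) + of_bool (\<tau> (k + Suc n))) * ?d (k + Suc n)) =
     L (Suc n) - (\<Sum>k. of_bool (\<sigma> (k + Suc n)) * ?d (k + Suc n)) +
      (\<Sum>k. of_bool (\<tau> (k + Suc n)) * ?d (k + Suc n))" .
  have "(\<Sum>k<n. of_bool (\<tau> k) * ?d k) = (\<Sum>k<n. of_bool (\<sigma> k) * ?d k)"
    using assms(1) by (intro sum.cong) auto
  then show ?thesis
    using assms eq by (simp add: split gap_def)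
qed

lemma point_le:
  assumes "\<And>i. i < n \<Longrightarrow> \<sigma> i = \<tau> i" and "\<not> \<sigma> n" "\<tau> n"
  shows "point \<sigma> + gap n \<le> point \<tau>"
proof -
  have "0 \<le> (\<Sum>k. (of_bool (\<not> \<sigma> (k + Suc n)) + of_bool (\<tau> (k + Suc n))) *
      (L (k + Suc n) - L (Suc k + Suc n)))"
    by (rule weighted_nonneg[of _ 2]) (auto simp: of_bool_def)
  then show ?thesis
    using point_diff[of n \<sigma> \<tau>, OF assms(1) assms(2,3)] by linarith
qed

lemma point_dist_le:
  assumes "\<And>i. i < n \<Longrightarrow> \<sigma> i = \<tau> i"
  shows "\<bar>point \<sigma> - point \<tau>\<bar> \<le> L n"
proof -
  let ?d = "\<lambda>k. L k - L (Suc k)"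
  have split: "point \<rho> = (\<Sum>k<n. of_bool (\<rho> k) * ?d k) + (\<Sum>k. of_bool (\<rho> (k + n)) * ?d (k + n))" for \<rho>
    unfolding point_def
    using weighted_summable[of "\<lambda>k. of_bool (\<rho> k)" 1 0]
    by (subst suminf_split_initial_segment[of _ n]) auto
  have head: "(\<Sum>k<n. of_bool (\<tau> k) * ?d k) = (\<Sum>k<n. of_bool (\<sigma> k) * ?d k)"
    using assms(1) by (intro sum.cong) auto
  have tail: "0 \<le> (\<Sum>k. of_bool (\<rho> (k + n)) * ?d (k + n)) \<and>
      (\<Sum>k. of_bool (\<rho> (k + n)) * ?d (k + n)) \<le> L n" for \<rho>
    using weighted_nonneg[of "\<lambda>k. of_bool (\<rho> (k + n))" 1 n] weighted_le[of "\<lambda>k. of_bool (\<rho> (k + n))" 1 n]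
    by simp
  show ?thesis
    unfolding abs_le_iff using split[of \<sigma>] split[of \<tau>] head tail[of \<sigma>] tail[of \<tau>] by linarith
qed

end

text \<open>
  The words w000... and w111... code the two endpoints of the interval w.
\<close>
definition extend :: "bool list \<Rightarrow> bool \<Rightarrow> nat \<Rightarrow> bool" where
  "extend w b k = (if k < length w then w ! k else b)"

definition initial :: "(nat \<Rightarrow> bool) \<Rightarrow> nat \<Rightarrow> bool list" where
  "initial \<sigma> n = map \<sigma> [0..<n]"

lemma length_initial [simp]: "length (initial \<sigma> n) = n"
  by (simp add: initial_def)

lemma nth_initial [simp]: "k < n \<Longrightarrow> initial \<sigma> n ! k = \<sigma> k"
  by (simp add: initial_def)

lemma initial_Suc: "initial \<sigma> (Suc n) = initial \<sigma> n @ [\<sigma> n]"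
  by (simp add: initial_def)

lemma extend_snoc_same [simp]: "extend (w @ [b]) b = extend w b"
  by (auto simp: extend_def fun_eq_iff nth_append less_Suc_eq)

lemma initial_eq_iff: "initial \<sigma> n = w \<longleftrightarrow> length w = n \<and> (\<forall>i<n. \<sigma> i = w ! i)"
  by (auto simp: list_eq_iff_nth_eq)

lemma ex_first_difference:
  fixes \<sigma> \<tau> :: "nat \<Rightarrow> bool"
  assumes "initial \<sigma> n \<noteq> initial \<tau> n"
  obtains j where "j < n" "\<sigma> j \<noteq> \<tau> j" "\<And>i. i < j \<Longrightarrow> \<sigma> i = \<tau> i"
proof -
  have ex: "\<exists>j. j < n \<and> \<sigma> j \<noteq> \<tau> j"
    using assms by (auto simp: list_eq_iff_nth_eq)
  define j where "j = (LEAST j. j < n \<and> \<sigma> j \<noteq> \<tau> j)"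
  have "j < n \<and> \<sigma> j \<noteq> \<tau> j" unfolding j_def by (rule LeastI_ex[OF ex])
  moreover have "\<sigma> i = \<tau> i" if "i < j" for i
    using not_less_Least[of i "\<lambda>j. j < n \<and> \<sigma> j \<noteq> \<tau> j"] that calculation unfolding j_def[symmetric] by auto
  ultimately show ?thesis using that by blast
qed

context halving_sequence begin

abbreviation left_end :: "bool list \<Rightarrow> real" where "left_end w \<equiv> point (extend w False)"
abbreviation right_end :: "bool list \<Rightarrow> real" where "right_end w \<equiv> point (extend w True)"

lemma right_end_minus_left_end: "right_end w - left_end w = L (length w)"
proof -
  have "right_end w - left_end w = gap (length w) + (\<Sum>k. 2 * (L (k + Suc (length w)) - L (Suc k + Suc (length w))))"
    by (subst point_diff[of "length w"]) (auto simp: extend_def)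
  also have "(\<Sum>k. 2 * (L (k + Suc (length w)) - L (Suc k + Suc (length w)))) = 2 * L (Suc (length w))"
    by (intro sums_unique[symmetric] sums_mult step_sums)
  finally show ?thesis by (simp add: gap_def)
qed

lemma left_end_snoc_True: "left_end (w @ [True]) - right_end (w @ [False]) = gap (length w)"
  by (subst point_diff[of "length w"]) (auto simp: extend_def nth_append)

lemma point_between:
  "left_end (initial \<sigma> n) \<le> point \<sigma>" "point \<sigma> \<le> right_end (initial \<sigma> n)"
proof -
  let ?d = "\<lambda>k. L k - L (Suc k)"
  have s: "summable (\<lambda>k. of_bool (\<rho> k) * ?d k)" for \<rho>
    using weighted_summable[of "\<lambda>k. of_bool (\<rho> k)" 1 0] by simp
  show "left_end (initial \<sigma> n) \<le> point \<sigma>" "point \<sigma> \<le> right_end (initial \<sigma> n)"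
    unfolding point_def using less_imp_le[OF step_pos]
    by (auto intro!: suminf_le s mult_right_mono simp: extend_def)
qed

lemma separated:
  assumes "length u = length v" "u \<noteq> v"
  shows "right_end u \<le> left_end v \<or> right_end v \<le> left_end u"
proof -
  obtain j where j: "j < length u" "extend u True j \<noteq> extend v False j"
      "\<And>i. i < j \<Longrightarrow> extend u True i = extend v False i"
    by (rule ex_first_difference[of "extend u True" "length u" "extend v False"])
       (use assms in \<open>auto simp: initial_eq_iff extend_def list_eq_iff_nth_eq\<close>)
  show ?thesis
  proof (cases "u ! j")
    case False
    then have "right_end u + gap j \<le> left_end v"
      using j assms by (intro point_le) (auto simp: extend_def)
    then show ?thesis using gap_nonneg[of j] by simp
  next
    case True
    then have "right_end v + gap j \<le> left_end u"
      using j assms by (intro point_le) (auto simp: extend_def)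
    then show ?thesis using gap_nonneg[of j] by simp
  qed
qed

end

lemma Cantor_intervals_eq:
  fixes c :: "nat \<Rightarrow> real"
  assumes "halving_sequence L" "L 0 = 1" "\<And>n. L (Suc n) = L n * (1 - c (Suc n)) / 2"
  shows "Cantor_intervals c n =
    (\<lambda>w. (halving_sequence.point L (extend w False), halving_sequence.point L (extend w True))) ` {w. length w = n}"
proof -
  interpret halving_sequence L by fact
  show ?thesis
  proof (induction n)
    case 0
    have "left_end [] = 0" by (simp add: point_def extend_def)
    moreover have "right_end [] = 1" using right_end_minus_left_end[of "[]"] calculation assms by simp
    ultimately show ?case by auto
  next
    case (Suc n)
    have r: "(left_end w + right_end w) / 2 - c (Suc n) * (right_end w - left_end w) / 2 = right_end (w @ [False])"
      and l: "(left_end w + right_end w) / 2 + c (Suc n) * (right_end w - left_end w) / 2 = left_end (w @ [True])"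
      if "length w = n" for w
      using right_end_minus_left_end[of w] right_end_minus_left_end[of "w @ [False]"]
        right_end_minus_left_end[of "w @ [True]"] assms(3)[of n] that
      by (auto simp: field_simps)
    have "Cantor_intervals c (Suc n) = (\<Union>w\<in>{w. length w = n}.
       {(left_end w, right_end (w @ [False])), (left_end (w @ [True]), right_end w)})"
      unfolding Cantor_intervals.simps Suc UN_simps(10) using r l by (intro SUP_cong) auto
    also have "\<dots> = (\<lambda>w. (left_end w, right_end w)) ` (\<Union>w\<in>{w. length w = n}. {w @ [False], w @ [True]})"
      unfolding image_UN by (intro SUP_cong) auto
    also have "(\<Union>w\<in>{w. length w = n}. {w @ [False], w @ [True]}) = {w :: bool list. length w = Suc n}"
    proof -
      have "w \<in> (\<Union>w\<in>{w. length w = n}. {w @ [False], w @ [True]})" if "length w = Suc n" for w :: "bool list"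
      proof -
        from that obtain u b where "w = u @ [b]" by (cases w rule: rev_cases) auto
        with that show ?thesis by (cases b) auto
      qed
      then show ?thesis by auto
    qed
    finally show ?case .
  qed
qed

text \<open>Dependent choice along binary words.\<close>
lemma ex_path:
  fixes P :: "bool list \<Rightarrow> bool"
  assumes "P []" and step: "\<And>w. P w \<Longrightarrow> \<exists>b. P (w @ [b])"
  obtains \<sigma> where "\<And>n. P (initial \<sigma> n)"
proof -
  define ch where "ch w = w @ [SOME b. P (w @ [b])]" for w
  define W where "W n = (ch ^^ n) []" for n
  have lenW: "length (W n) = n" for n by (induction n) (auto simp: W_def ch_def)
  have PW: "P (W n)" for n
  proof (induction n)
    case 0 then show ?case using assms by (simp add: W_def)
  next
    case (Suc n)
    have "P (ch (W n))" unfolding ch_def by (rule someI_ex) (rule step[OF Suc])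
    then show ?case by (simp add: W_def)
  qed
  define \<sigma> where "\<sigma> n = last (W (Suc n))" for n
  have "initial \<sigma> n = W n" for n
  proof (induction n)
    case 0 then show ?case by (simp add: W_def initial_def)
  next
    case (Suc n)
    have "W (Suc n) = W n @ [\<sigma> n]" by (simp add: W_def ch_def \<sigma>_def)
    with Suc show ?case by (simp add: initial_Suc)
  qed
  with PW that show ?thesis by metis
qed

text \<open>
  A point of E lies in some interval of every step, but the intervals found need not be nested: if a
  gap is empty, neighbouring intervals share an endpoint. Such a point is an endpoint of both
  intervals and remains an endpoint in all later steps, so an interval of step n that contains a
  point of E always has a child that contains it. Following the children gives a code.
\<close>
lemma middle_interval_Cantor_set_eq_range:
  assumes "middle_interval_Cantor_set E"
  obtains L where "halving_sequence L" "L 0 = 1" "E = range (halving_sequence.point L)"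
proof -
  obtain c where c: "\<And>i. i \<ge> 1 \<Longrightarrow> 0 \<le> c i" "\<And>i. i \<ge> 1 \<Longrightarrow> c i < 1"
    and E: "E = (\<Inter>n. \<Union>(a, b) \<in> Cantor_intervals c n. {a..b})"
    using assms unfolding middle_interval_Cantor_set_def by auto
  define L where "L n = (\<Prod>i=1..n. (1 - c i) / 2)" for n
  have LS: "L (Suc n) = L n * (1 - c (Suc n)) / 2" for n
    by (simp add: L_def)
  have Lpos: "0 < L n" for n
    unfolding L_def using c by (intro prod_pos) auto
  interpret halving_sequence L
  proof
    show "2 * L (Suc n) \<le> L n" for n
      using Lpos[of n] c(1)[of "Suc n"] by (simp add: LS mult_left_le)
  qed (rule Lpos)
  have L0: "L 0 = 1" by (simp add: L_def)
  have E': "E = (\<Inter>n. \<Union>w \<in> {w. length w = n}. {left_end w..right_end w})"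
    unfolding E Cantor_intervals_eq[of L c, OF halving_sequence_axioms L0 LS] by simp
  have "point \<sigma> \<in> E" for \<sigma>
  proof -
    have "\<exists>w. length w = n \<and> left_end w \<le> point \<sigma> \<and> point \<sigma> \<le> right_end w" for n
      using point_between[of \<sigma> n] by (intro exI[of _ "initial \<sigma> n"]) simp
    then show ?thesis unfolding E' by auto
  qed
  moreover have "x \<in> range point" if x: "x \<in> E" for x
  proof -
    have ex: "\<exists>v. length v = m \<and> left_end v \<le> x \<and> x \<le> right_end v" for m
      using x unfolding E' by auto
    obtain \<sigma> where \<sigma>: "\<And>n. left_end (initial \<sigma> n) \<le> x \<and> x \<le> right_end (initial \<sigma> n)"
    proof (rule ex_path[of "\<lambda>w. left_end w \<le> x \<and> x \<le> right_end w"])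
      show "left_end [] \<le> x \<and> x \<le> right_end []" using ex[of 0] by simp
    next
      fix w assume w: "left_end w \<le> x \<and> x \<le> right_end w"
      obtain v where v: "length v = Suc (length w)" "left_end v \<le> x" "x \<le> right_end v"
        using ex by blast
      then obtain u b where vu: "v = u @ [b]" by (cases v rule: rev_cases) auto
      have u: "left_end u \<le> x \<and> x \<le> right_end u"
      proof (cases b)
        case True
        then show ?thesis
          using v vu right_end_minus_left_end[of "u @ [False]"] left_end_snoc_True[of u]
            gap_nonneg[of "length u"] pos[of "Suc (length u)"] by simp
      next
        case False
        then show ?thesis
          using v vu right_end_minus_left_end[of "u @ [True]"] left_end_snoc_True[of u]
            gap_nonneg[of "length u"] pos[of "Suc (length u)"] by simp
      qed
      show "\<exists>b. left_end (w @ [b]) \<le> x \<and> x \<le> right_end (w @ [b])"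
      proof (cases "u = w")
        case True
        then show ?thesis using v vu by auto
      next
        case False
        then have "right_end u \<le> left_end w \<or> right_end w \<le> left_end u"
          using v vu by (intro separated) auto
        then have "x = left_end w \<or> x = right_end w"
          using u w by linarith
        then show ?thesis
        proof
          assume "x = left_end w"
          then show ?thesis
            using right_end_minus_left_end[of "w @ [False]"] pos[of "Suc (length w)"] by (intro exI[of _ False]) auto
        next
          assume "x = right_end w"
          then show ?thesis
            using right_end_minus_left_end[of "w @ [True]"] pos[of "Suc (length w)"] by (intro exI[of _ True]) auto
        qed
      qed
    qed (rule that)
    have "\<bar>x - point \<sigma>\<bar> \<le> L n" for n
      using \<sigma>[of n] point_between[of \<sigma> n] right_end_minus_left_end[of "initial \<sigma> n"] by auto
    then have "x = point \<sigma>"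
      using ex_less[of "\<bar>x - point \<sigma>\<bar>"] by (metis abs_eq_0 eq_iff_diff_eq_0 leD zero_less_abs_iff)
    then show ?thesis by simp
  qed
  ultimately have "E = range point" by auto
  then show ?thesis using that[of L] halving_sequence_axioms L0 by simp
qed

section \<open>Hausdorff measure and coverings\<close>

lemma mdiam_le:
  assumes "\<And>x y. x \<in> U \<Longrightarrow> y \<in> U \<Longrightarrow> mdist X x y \<le> r"
  shows "mdiam X U \<le> ennreal r"
  unfolding mdiam_def using assms by (auto intro!: SUP_least ennreal_leI)

lemma mdist_le_mdiam:
  assumes "x \<in> U" "y \<in> U" "mdiam X U \<le> ennreal r"
  shows "mdist X x y \<le> enn2real (mdiam X U)"
proof -
  have "ennreal (mdist X x y) \<le> mdiam X U"
    unfolding mdiam_def using assms by (intro SUP_upper2[OF assms(1)] SUP_upper2[OF assms(2)]) simp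
  moreover have "mdiam X U < \<infinity>"
    using assms(3) by (rule le_less_trans) simp
  ultimately show ?thesis
    using enn2real_mono[of "ennreal (mdist X x y)" "mdiam X U"] by (simp add: less_top)
qed

lemma Hausdorff_dim_le:
  assumes "s > 0" "Hausdorff_measure X s = 0"
  shows "Hausdorff_dim X \<le> ennreal s"
  unfolding Hausdorff_dim_def using assms by (intro INF_lower) auto

lemma Hausdorff_dim_greatest:
  assumes "\<And>s. s > 0 \<Longrightarrow> Hausdorff_measure X s = 0 \<Longrightarrow> d \<le> ennreal s"
  shows "d \<le> Hausdorff_dim X"
  unfolding Hausdorff_dim_def using assms by (intro INF_greatest) auto

text \<open>
  The mesh of the coverings takes care of itself: 2^n r^s can only be small if r is.
\<close>
lemma Hausdorff_measure_eq_0: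
  fixes r :: "nat \<Rightarrow> real"
  assumes s: "s > 0" and r: "\<And>n. 0 \<le> r n"
    and small: "\<And>a. a > 0 \<Longrightarrow> \<exists>n. 2 ^ n * r n powr s < a"
    and cover: "\<And>n. mspace X \<subseteq> (\<Union>w\<in>{w :: bool list. length w = n}. V w)"
    and diam: "\<And>w x y. x \<in> V w \<Longrightarrow> y \<in> V w \<Longrightarrow> mdist X x y \<le> r (length w)"
  shows "Hausdorff_measure X s = 0"
proof -
  have "Hausdorff_content X s \<delta> \<le> ennreal a" if \<delta>: "\<delta> > 0" and a: "a > 0" for \<delta> a
  proof -
    obtain n where n: "2 ^ n * r n powr s < min a (\<delta> powr s)"
      using small[of "min a (\<delta> powr s)"] a \<delta> by auto
    have "r n powr s \<le> 2 ^ n * r n powr s"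
      using mult_right_mono[of 1 "2 ^ n" "r n powr s"] by simp
    then have "r n powr s < \<delta> powr s" using n by linarith
    then have rd: "r n \<le> \<delta>"
      using r[of n] s \<delta> powr_mono2[of s \<delta> "r n"] by (meson less_eq_real_def linorder_not_le)
    have fin: "finite {w :: bool list. length w = n}"
      using finite_lists_length_eq[of "UNIV :: bool set" n] by simp
    have card: "card {w :: bool list. length w = n} = 2 ^ n"
      using card_lists_length_eq[of "UNIV :: bool set" n] by simp
    obtain h :: "nat \<Rightarrow> bool list" where h: "bij_betw h {0..<2 ^ n} {w :: bool list. length w = n}"
      using ex_bij_betw_nat_finite[OF fin] unfolding card by auto
    define U where "U i = (if i < 2 ^ n then V (h i) \<inter> mspace X else {})" for i
    have len: "length (h i) = n" if "i < 2 ^ n" for i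
      using bij_betwE[OF h] that by auto
    have dU: "mdiam X (U i) \<le> ennreal (if i < 2 ^ n then r n else 0)" for i
    proof (rule mdiam_le)
      fix x y assume "x \<in> U i" "y \<in> U i"
      then show "mdist X x y \<le> (if i < 2 ^ n then r n else 0)"
        using diam[of x "h i" y] len[of i] by (auto simp: U_def split: if_splits)
    qed
    have "mspace X \<subseteq> (\<Union>i. U i)"
    proof
      fix x assume x: "x \<in> mspace X"
      then obtain w where w: "length w = n" "x \<in> V w" using cover[of n] by auto
      have "w \<in> h ` {0..<2 ^ n}" using bij_betw_imp_surj_on[OF h] w by simp
      then obtain i where "i < 2 ^ n" "h i = w" by auto
      then show "x \<in> (\<Union>i. U i)" using w x by (auto simp: U_def intro!: exI[of _ i])
    qed
    moreover have "mdiam X (U i) \<le> ennreal \<delta>" for i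
      using dU[of i] rd \<delta> by (auto elim!: order_trans intro!: ennreal_leI split: if_splits)
    moreover have "U i \<subseteq> mspace X" for i by (auto simp: U_def)
    ultimately have "Hausdorff_content X s \<delta> \<le> (\<Sum>i. ennreal (enn2real (mdiam X (U i)) powr s))"
      unfolding Hausdorff_content_def by (intro INF_lower) auto
    also have "\<dots> = (\<Sum>i<2 ^ n. ennreal (enn2real (mdiam X (U i)) powr s))"
    proof (rule suminf_finite)
      fix i :: nat assume "i \<notin> {..<2 ^ n}"
      then have "mdiam X (U i) = 0" using dU[of i] by simp
      then show "ennreal (enn2real (mdiam X (U i)) powr s) = 0" by simp
    qed simp
    also have "\<dots> \<le> (\<Sum>i::nat<2 ^ n. ennreal (r n powr s))"
    proof (intro sum_mono ennreal_leI powr_mono2)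
      fix i :: nat assume "i \<in> {..<2 ^ n}"
      then have "mdiam X (U i) \<le> ennreal (r n)" using dU[of i] by simp
      then show "enn2real (mdiam X (U i)) \<le> r n"
        using r[of n] enn2real_mono[of "mdiam X (U i)" "ennreal (r n)"] by simp
    qed (use s in auto)
    also have "\<dots> = ennreal (2 ^ n * r n powr s)"
      by (simp add: ennreal_mult' ennreal_power[symmetric])
    also have "\<dots> \<le> ennreal a" using n by (intro ennreal_leI) simp
    finally show ?thesis .
  qed
  note content = this
  have "Hausdorff_content X s \<delta> \<le> 0" if "\<delta> > 0" for \<delta>
  proof (rule ennreal_le_epsilon)
    fix a :: real assume "0 < a"
    then show "Hausdorff_content X s \<delta> \<le> 0 + ennreal a" using content[OF that] by simp
  qed
  then have "Hausdorff_measure X s \<le> 0"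
    unfolding Hausdorff_measure_def by (intro SUP_least) simp
  then show ?thesis by simp
qed

section \<open>Subadditive weights on binary words\<close>

text \<open>
  If the words of the family below v had total weight less than m v, then v would not belong to the
  family, and by subadditivity the same would hold for one of the two children of v. Starting at the
  empty word, this produces an infinite sequence none of whose initial segments is in the family.
\<close>
lemma root_le_sum_of_bar:
  fixes m :: "bool list \<Rightarrow> ennreal"
  assumes sub: "\<And>w. m w \<le> m (w @ [False]) + m (w @ [True])"
    and fin: "\<And>i. finite (W i)"
    and bar: "\<And>\<sigma>. \<exists>i n. initial \<sigma> n \<in> W i"
  shows "m [] \<le> (\<Sum>i::nat. \<Sum>w\<in>W i. m w)"
proof (rule ccontr)
  define below where "below v w \<longleftrightarrow> (\<exists>u. w = v @ u)" for v w :: "bool list"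
  define A where "A v = (\<Sum>i. \<Sum>w\<in>W i. if below v w then m w else 0)" for v
  assume "\<not> ?thesis"
  then have root: "A [] < m []"
    by (simp add: A_def below_def not_le)
  have bar_le: "m v \<le> A v" if "v \<in> W i" for v i
  proof -
    have "m v = (if below v v then m v else 0)" by (auto simp: below_def)
    also have "\<dots> \<le> (\<Sum>w\<in>W i. if below v w then m w else 0)"
      using fin that by (intro member_le_sum) auto
    also have "\<dots> \<le> A v"
      unfolding A_def using sum_le_suminf[OF summableI, of "{i}" "\<lambda>i. \<Sum>w\<in>W i. if below v w then m w else 0"]
      by simp
    finally show ?thesis .
  qed
  have split: "A (v @ [False]) + A (v @ [True]) \<le> A v" for v
  proof -
    have "A (v @ [False]) + A (v @ [True]) =
      (\<Sum>i. \<Sum>w\<in>W i. (if below (v @ [False]) w then m w else 0) + (if below (v @ [True]) w then m w else 0))"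
      unfolding A_def sum.distrib by (intro suminf_add summableI)
    also have "\<dots> \<le> A v"
      unfolding A_def by (intro suminf_le sum_mono summableI) (auto simp: below_def)
    finally show ?thesis .
  qed
  have step: "\<exists>b. A (v @ [b]) < m (v @ [b])" if v: "A v < m v" for v
  proof -
    show "\<exists>b. A (v @ [b]) < m (v @ [b])"
    proof (rule ccontr)
      assume "\<not> ?thesis"
      then have "m (v @ [False]) + m (v @ [True]) \<le> A (v @ [False]) + A (v @ [True])"
        by (intro add_mono) (auto simp: not_less)
      with split[of v] sub[of v] v show False by (meson leD order_trans)
    qed
  qed
  obtain \<sigma> where \<sigma>: "\<And>n. A (initial \<sigma> n) < m (initial \<sigma> n)"
    using ex_path[of "\<lambda>v. A v < m v", OF root step] by blast
  obtain i n where "initial \<sigma> n \<in> W i" using bar by blast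
  with bar_le \<sigma>[of n] show False by (meson leD)
qed

context halving_sequence begin

text \<open>
  Of three intervals of length L n with disjoint interiors, the middle one separates the two others by
  L n.
\<close>
lemma card_cylinders_le_2:
  assumes V: "\<And>\<sigma> \<tau>. point \<sigma> \<in> V \<Longrightarrow> point \<tau> \<in> V \<Longrightarrow> \<bar>point \<sigma> - point \<tau>\<bar> < L n"
  shows "card {initial \<sigma> n |\<sigma>. point \<sigma> \<in> V} \<le> 2"
proof (rule ccontr)
  assume "\<not> ?thesis"
  then have "3 \<le> card {initial \<sigma> n |\<sigma>. point \<sigma> \<in> V}" by simp
  then obtain T where T: "T \<subseteq> {initial \<sigma> n |\<sigma>. point \<sigma> \<in> V}" "card T = 3"
    by (rule obtain_subset_with_card_n) 
  then obtain u v w where uvw: "T = {u, v, w}" "u \<noteq> v" "v \<noteq> w" "u \<noteq> w"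
    by (auto simp: card_3_iff)
  obtain \<sigma> where \<sigma>: "u = initial \<sigma> n" "point \<sigma> \<in> V" using T uvw by auto
  obtain \<tau> where \<tau>: "v = initial \<tau> n" "point \<tau> \<in> V" using T uvw by auto
  obtain \<rho> where \<rho>: "w = initial \<rho> n" "point \<rho> \<in> V" using T uvw by auto
  have "\<bar>point \<sigma> - point \<tau>\<bar> < L n" "\<bar>point \<tau> - point \<rho>\<bar> < L n" "\<bar>point \<sigma> - point \<rho>\<bar> < L n"
    using V \<sigma> \<tau> \<rho> by auto
  moreover have "right_end u \<le> left_end v \<or> right_end v \<le> left_end u"
      "right_end v \<le> left_end w \<or> right_end w \<le> left_end v"
      "right_end u \<le> left_end w \<or> right_end w \<le> left_end u"
    using uvw \<sigma>(1) \<tau>(1) \<rho>(1) by (intro separated; simp)+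
  moreover have "right_end u - left_end u = L n" "right_end v - left_end v = L n" "right_end w - left_end w = L n"
    using \<sigma> \<tau> \<rho> right_end_minus_left_end by auto
  moreover have "left_end u \<le> point \<sigma>" "point \<sigma> \<le> right_end u" "left_end v \<le> point \<tau>" "point \<tau> \<le> right_end v"
     "left_end w \<le> point \<rho>" "point \<rho> \<le> right_end w"
    using point_between \<sigma> \<tau> \<rho> by auto
  ultimately show False by (elim disjE) linarith+
qed

lemma finite_cylinders: "finite {initial \<sigma> n |\<sigma>. P \<sigma>}"
  by (rule finite_subset[OF _ finite_lists_length_eq[of "UNIV :: bool set" n]]) auto

lemma card_cylinders_Suc_le:
  "card {initial \<sigma> (Suc n) |\<sigma>. P \<sigma>} \<le> 2 * card {initial \<sigma> n |\<sigma>. P \<sigma>}"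
proof -
  have "card {initial \<sigma> (Suc n) |\<sigma>. P \<sigma>} \<le> card ((\<lambda>(w, b). w @ [b]) ` ({initial \<sigma> n |\<sigma>. P \<sigma>} \<times> UNIV))"
    by (intro card_mono finite_imageI finite_cartesian_product finite_cylinders finite)
       (auto simp: initial_Suc)
  also have "\<dots> \<le> card ({initial \<sigma> n |\<sigma>. P \<sigma>} \<times> (UNIV :: bool set))"
    by (intro card_image_le finite_cartesian_product finite_cylinders finite)
  finally show ?thesis by (simp add: card_cartesian_product)
qed

text \<open>
  A set U of the covering is replaced by few words. Let V be its preimage in the Cantor set and k
  the first level with two points of V at distance at least L k. Then V meets at most two
  intervals of level k - 1, hence at most four of level k, and every point of V has another point of V
  at distance at least L k / 2. By weak quasisymmetry the image of an interval of level k that meets V is not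
  much larger than U. So the weight of these words is at most a multiple of the s-th power of the
  diameter of U, and the family of all words obtained is hit by every code. Sets U whose preimage is a
  single point give no such level; for them, words of small weight are used.
\<close>
lemma Hausdorff_measure_neq_0:
  fixes f :: "real \<Rightarrow> 'b" and Z :: "'b metric" and m :: "bool list \<Rightarrow> real"
  assumes Z: "mspace Z = f ` range point"
    and H: "1 \<le> H"
    and weak: "\<And>x y z. x \<in> range point \<Longrightarrow> y \<in> range point \<Longrightarrow> z \<in> range point \<Longrightarrow>
        \<bar>x - y\<bar> \<le> 2 * \<bar>y - z\<bar> \<Longrightarrow> mdist Z (f x) (f y) \<le> H * mdist Z (f y) (f z)"
    and m: "\<And>w. 0 \<le> m w" "0 < m []" "\<And>w. m w \<le> m (w @ [False]) + m (w @ [True])"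
    and tiny: "\<And>e. 0 < e \<Longrightarrow> \<exists>n. \<forall>w. length w = n \<longrightarrow> m w < e"
    and s: "0 < s" and C: "0 < C"
    and le: "\<And>w. m w \<le> C * mdist Z (f (left_end w)) (f (right_end w)) powr s"
  shows "Hausdorff_measure Z s \<noteq> 0"
proof -
  define M where "M = 4 * (C * (2 * H) powr s)"
  have M: "0 < M" using C H by (simp add: M_def)
  have "ennreal (m [] / (2 * M)) \<le> Hausdorff_content Z s 1"
    unfolding Hausdorff_content_def
  proof (rule INF_greatest)
    fix U :: "nat \<Rightarrow> 'b set"
    assume "U \<in> {U. (\<forall>i. U i \<subseteq> mspace Z \<and> mdiam Z (U i) \<le> ennreal 1) \<and> mspace Z \<subseteq> (\<Union>i. U i)}"
    then have U: "\<And>i. mdiam Z (U i) \<le> ennreal 1" "mspace Z \<subseteq> (\<Union>i. U i)" by auto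
    define d where "d i = enn2real (mdiam Z (U i))" for i
    \<comment> \<open>Errors allowed for single points; they add up to half of the weight of the empty word.\<close>
    define e where "e i = m [] / 2 * (1/2) ^ Suc i" for i :: nat
    have epos: "0 < e i" for i using m by (simp add: e_def)
    define V where "V i = {x \<in> range point. f x \<in> U i}" for i
    have dist_le: "mdist Z (f x) (f y) \<le> d i" if "x \<in> V i" "y \<in> V i" for x y i
      using that U(1)[of i] unfolding d_def V_def by (intro mdist_le_mdiam[of _ _ _ _ 1]) auto
    have "\<exists>k. (\<Sum>w\<in>{initial \<sigma> k |\<sigma>. point \<sigma> \<in> V i}. m w) \<le> M * d i powr s + e i" for i
    proof (cases "\<exists>\<sigma> \<tau>. point \<sigma> \<in> V i \<and> point \<tau> \<in> V i \<and> point \<sigma> \<noteq> point \<tau>")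
      case False
      obtain n where n: "\<And>w. length w = n \<Longrightarrow> m w < e i / 2" using tiny[of "e i / 2"] epos by auto
      have "(\<Sum>w\<in>{initial \<sigma> n |\<sigma>. point \<sigma> \<in> V i}. m w) \<le> of_nat (card {initial \<sigma> n |\<sigma>. point \<sigma> \<in> V i}) * (e i / 2)"
        using n by (intro sum_bounded_above) (auto intro: less_imp_le)
      also have "\<dots> \<le> 2 * (e i / 2)"
      proof (rule mult_right_mono)
        have "card {initial \<sigma> n |\<sigma>. point \<sigma> \<in> V i} \<le> 2"
          using False pos by (intro card_cylinders_le_2) (metis abs_zero diff_self)
        then show "real (card {initial \<sigma> n |\<sigma>. point \<sigma> \<in> V i}) \<le> 2" by simp
      qed (use epos[of i] in simp)
      also have "\<dots> \<le> M * d i powr s + e i" using M by simp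
      finally show ?thesis by blast
    next
      case True
      \<comment> \<open>The first level whose intervals are at most as long as V is wide.\<close>
      define far where "far k \<longleftrightarrow> (\<exists>\<sigma> \<tau>. point \<sigma> \<in> V i \<and> point \<tau> \<in> V i \<and> L k \<le> \<bar>point \<sigma> - point \<tau>\<bar>)" for k
      have "\<exists>k. far k"
        using True ex_less unfolding far_def by (metis less_imp_le right_minus_eq zero_less_abs_iff)
      define k where "k = (LEAST k. far k)"
      have "far k" unfolding k_def by (rule LeastI_ex) fact
      then obtain \<sigma> \<tau> where far: "point \<sigma> \<in> V i" "point \<tau> \<in> V i" "L k \<le> \<bar>point \<sigma> - point \<tau>\<bar>"
        unfolding far_def by blast
      have card: "card {initial \<sigma> k |\<sigma>. point \<sigma> \<in> V i} \<le> 4"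
      proof (cases k)
        case 0
        have "card {initial \<sigma> k |\<sigma>. point \<sigma> \<in> V i} \<le> card {[] :: bool list}"
          by (rule card_mono) (auto simp: 0 initial_def)
        then show ?thesis by simp
      next
        case (Suc n)
        then have "\<not> far n" unfolding k_def by (metis Suc_n_not_le_n Least_le)
        then have "card {initial \<sigma> n |\<sigma>. point \<sigma> \<in> V i} \<le> 2"
          by (intro card_cylinders_le_2) (auto simp: far_def not_le)
        then show ?thesis
          using card_cylinders_Suc_le[of n "\<lambda>\<sigma>. point \<sigma> \<in> V i"] unfolding Suc by linarith
      qed
      have "m w \<le> C * (2 * H) powr s * d i powr s" if w: "w \<in> {initial \<sigma> k |\<sigma>. point \<sigma> \<in> V i}" for w
      proof -
        obtain \<rho> where \<rho>: "w = initial \<rho> k" "point \<rho> \<in> V i" using w by auto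
        obtain z where z: "z \<in> V i" "L k \<le> 2 * \<bar>point \<rho> - z\<bar>"
        proof (cases "L k \<le> 2 * \<bar>point \<rho> - point \<sigma>\<bar>")
          case False
          moreover have "\<bar>point \<sigma> - point \<tau>\<bar> \<le> \<bar>point \<rho> - point \<sigma>\<bar> + \<bar>point \<rho> - point \<tau>\<bar>" by linarith
          moreover have "a \<le> 2 * c" if "\<not> a \<le> 2 * b" "d \<le> b + c" "a \<le> d" for a b c d :: real
            using that by linarith
          ultimately have "L k \<le> 2 * \<bar>point \<rho> - point \<tau>\<bar>" using far(3) by blast
          then show ?thesis using that far by blast
        qed (use that far in blast)
        have R: "point \<rho> \<in> range point" "z \<in> range point" using z by (auto simp: V_def)
        have "mdist Z (f (left_end w)) (f (point \<rho>)) \<le> H * mdist Z (f (point \<rho>)) (f z)"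
             "mdist Z (f (right_end w)) (f (point \<rho>)) \<le> H * mdist Z (f (point \<rho>)) (f z)"
          using point_between[of \<rho> k] right_end_minus_left_end[of w] z \<rho> R by (auto intro!: weak)
        moreover have "mdist Z (f (point \<rho>)) (f z) \<le> d i" using \<rho> z dist_le by blast
        then have "H * mdist Z (f (point \<rho>)) (f z) \<le> H * d i" using H by (intro mult_left_mono) auto
        moreover have "mdist Z (f (left_end w)) (f (right_end w)) \<le>
            mdist Z (f (left_end w)) (f (point \<rho>)) + mdist Z (f (point \<rho>)) (f (right_end w))"
          by (rule mdist_triangle) (auto simp: Z)
        ultimately have "mdist Z (f (left_end w)) (f (right_end w)) \<le> 2 * H * d i"
          using mdist_commute[of Z "f (point \<rho>)" "f (right_end w)"] by linarith
        then have "mdist Z (f (left_end w)) (f (right_end w)) powr s \<le> (2 * H * d i) powr s"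
          using s by (intro powr_mono2) auto
        also have "\<dots> = (2 * H) powr s * d i powr s" using H by (simp add: powr_mult d_def)
        finally have "C * mdist Z (f (left_end w)) (f (right_end w)) powr s \<le> C * ((2 * H) powr s * d i powr s)"
          using C by (intro mult_left_mono) auto
        with le[of w] show ?thesis by (simp add: mult.assoc)
      qed
      then have "(\<Sum>w\<in>{initial \<sigma> k |\<sigma>. point \<sigma> \<in> V i}. m w) \<le>
          of_nat (card {initial \<sigma> k |\<sigma>. point \<sigma> \<in> V i}) * (C * (2 * H) powr s * d i powr s)"
        by (intro sum_bounded_above) auto
      also have "\<dots> \<le> 4 * (C * (2 * H) powr s * d i powr s)"
        using card C H by (intro mult_right_mono) auto
      also have "\<dots> \<le> M * d i powr s + e i" using epos[of i] by (simp add: M_def)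
      finally show ?thesis by blast
    qed
    then have "\<exists>k. \<forall>i. (\<Sum>w\<in>{initial \<sigma> (k i) |\<sigma>. point \<sigma> \<in> V i}. m w) \<le> M * d i powr s + e i"
      by (intro choice allI)
    then obtain k where k: "\<forall>i. (\<Sum>w\<in>{initial \<sigma> (k i) |\<sigma>. point \<sigma> \<in> V i}. m w) \<le> M * d i powr s + e i"
      by (rule exE)
    have "ennreal (m []) \<le> (\<Sum>i. \<Sum>w\<in>{initial \<sigma> (k i) |\<sigma>. point \<sigma> \<in> V i}. ennreal (m w))"
    proof (rule root_le_sum_of_bar)
      show "ennreal (m w) \<le> ennreal (m (w @ [False])) + ennreal (m (w @ [True]))" for w
        using m by (simp add: ennreal_plus[symmetric] ennreal_leI del: ennreal_plus)
      show "\<exists>i n. initial \<sigma> n \<in> {initial \<sigma> (k i) |\<sigma>. point \<sigma> \<in> V i}" for \<sigma>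
      proof -
        have "f (point \<sigma>) \<in> mspace Z" unfolding Z by simp
        then have "f (point \<sigma>) \<in> (\<Union>i. U i)" using U(2) by (rule subsetD[rotated])
        then obtain i where "f (point \<sigma>) \<in> U i" by auto
        then have "initial \<sigma> (k i) \<in> {initial \<sigma> (k i) |\<sigma>. point \<sigma> \<in> V i}" by (auto simp: V_def)
        then show ?thesis by blast
      qed
    qed (rule finite_cylinders)
    also have "\<dots> \<le> (\<Sum>i. ennreal M * ennreal (d i powr s) + ennreal (e i))"
    proof (intro suminf_le summableI)
      fix i
      have "(\<Sum>w\<in>{initial \<sigma> (k i) |\<sigma>. point \<sigma> \<in> V i}. ennreal (m w)) =
          ennreal (\<Sum>w\<in>{initial \<sigma> (k i) |\<sigma>. point \<sigma> \<in> V i}. m w)"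
        using m by (intro sum_ennreal) auto
      also have "\<dots> \<le> ennreal (M * d i powr s + e i)" by (intro ennreal_leI k[rule_format])
      also have "\<dots> = ennreal M * ennreal (d i powr s) + ennreal (e i)"
        using M epos[of i] by (simp add: ennreal_mult)
      finally show "(\<Sum>w\<in>{initial \<sigma> (k i) |\<sigma>. point \<sigma> \<in> V i}. ennreal (m w)) \<le>
          ennreal M * ennreal (d i powr s) + ennreal (e i)" .
    qed
    also have "\<dots> = ennreal M * (\<Sum>i. ennreal (d i powr s)) + (\<Sum>i. ennreal (e i))"
      by (simp add: suminf_add[symmetric] summableI)
    also have "(\<Sum>i. ennreal (e i)) = ennreal (m [] / 2)"
    proof (rule suminf_ennreal_eq)
      show "e sums (m [] / 2)"
        unfolding e_def using sums_mult[OF power_half_series, of "m [] / 2"] by simp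
    qed (use epos less_imp_le in blast)
    also have "ennreal M * (\<Sum>i. ennreal (d i powr s)) + ennreal (m [] / 2) =
        ennreal (m [] / 2) + ennreal M * (\<Sum>i. ennreal (d i powr s))"
      by (rule add.commute)
    finally have "ennreal (m [] / 2) + ennreal (m [] / 2) \<le>
        ennreal (m [] / 2) + ennreal M * (\<Sum>i. ennreal (d i powr s))"
      using m by (simp add: ennreal_plus[symmetric] del: ennreal_plus)
    then have "ennreal (m [] / 2) \<le> ennreal M * (\<Sum>i. ennreal (d i powr s))"
      by (simp only: ennreal_add_left_cancel_le) simp
    then have "ennreal (m [] / 2) / ennreal M \<le> (\<Sum>i. ennreal (d i powr s))"
      using M by (simp add: divide_le_posI_ennreal mult.commute)
    then show "ennreal (m [] / (2 * M)) \<le> (\<Sum>i. ennreal (enn2real (mdiam Z (U i)) powr s))"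
      using M m by (simp add: d_def divide_ennreal)
  qed
  also have "\<dots> \<le> Hausdorff_measure Z s"
    unfolding Hausdorff_measure_def by (rule SUP_upper) simp
  finally show ?thesis using m M by auto
qed

end

section \<open>Hausdorff dimension in terms of interval lengths\<close>

context halving_sequence begin

lemma Hausdorff_measure_eq_0_of_range:
  assumes X: "mspace X \<subseteq> range point" "\<And>x y. mdist X x y = \<bar>x - y\<bar>"
    and s: "0 < s" and small: "\<And>a. 0 < a \<Longrightarrow> \<exists>n. 2 ^ n * L n powr s < a"
  shows "Hausdorff_measure X s = 0"
proof (rule Hausdorff_measure_eq_0[OF s])
  show "mspace X \<subseteq> (\<Union>w\<in>{w. length w = n}. {point \<sigma> |\<sigma>. initial \<sigma> (length w) = w})" for n
  proof
    fix x assume "x \<in> mspace X"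
    then obtain \<sigma> where "x = point \<sigma>" using X by auto
    then show "x \<in> (\<Union>w\<in>{w. length w = n}. {point \<sigma> |\<sigma>. initial \<sigma> (length w) = w})"
      by (intro UN_I[of "initial \<sigma> n"]) auto
  qed
  show "mdist X x y \<le> L (length w)"
    if "x \<in> {point \<sigma> |\<sigma>. initial \<sigma> (length w) = w}" "y \<in> {point \<sigma> |\<sigma>. initial \<sigma> (length w) = w}" for w x y
    using that by (auto simp: X initial_eq_iff intro!: point_dist_le)
qed (auto intro: less_imp_le pos small)

text \<open>The weight 2^(-n) on words of length n, for the inclusion of E into the line.\<close>
lemma Hausdorff_measure_eq_0_imp_small:
  assumes s: "0 < s" and 0: "Hausdorff_measure (submetric euclidean_metric (range point)) s = 0" and a: "0 < a"
  shows "\<exists>n. 2 ^ n * L n powr s < a"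
proof (rule ccontr)
  assume "\<not> ?thesis"
  then have ge: "a \<le> 2 ^ n * L n powr s" for n by (auto simp: not_less)
  have "Hausdorff_measure (submetric euclidean_metric (range point)) s \<noteq> 0"
  proof (rule Hausdorff_measure_neq_0[where f = "\<lambda>x. x" and H = 2 and m = "\<lambda>w. (1/2) ^ length w" and C = "1 / a"])
    show "(1/2) ^ length w \<le> 1 / a * mdist (submetric euclidean_metric (range point)) (left_end w) (right_end w) powr s" for w
      using ge[of "length w"] right_end_minus_left_end[of w] a pos[of "length w"]
      by (simp add: dist_real_def abs_minus_commute[of "left_end w"] field_simps power_divide)
    show "\<exists>n. \<forall>w. length w = n \<longrightarrow> (1/2) ^ length w < e" if "0 < e" for e :: real
      using real_arch_pow_inv[OF that, of "1/2"] by auto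
  qed (use s a in \<open>auto simp: dist_real_def\<close>)
  with 0 show False by simp
qed

lemma Hausdorff_dim_le_1:
  assumes "L 0 = 1"
  shows "Hausdorff_dim (submetric euclidean_metric (range point)) \<le> 1"
proof (rule ennreal_le_epsilon)
  fix e :: real assume e: "0 < e"
  have "Hausdorff_measure (submetric euclidean_metric (range point)) (1 + e) = 0"
  proof (rule Hausdorff_measure_eq_0_of_range)
    fix a :: real assume "0 < a"
    then obtain n where n: "L n < a powr (1 / e)" using ex_less[of "a powr (1 / e)"] by auto
    have "2 ^ n * L n powr (1 + e) = (2 ^ n * L n) * L n powr e"
      using pos[of n] by (simp add: powr_add)
    also have "\<dots> \<le> 1 * L n powr e"
      using power2_mult_le[of n 0] assms by (intro mult_right_mono) auto
    also have "\<dots> < (a powr (1 / e)) powr e"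
      using n e pos[of n] powr_less_mono2[of e "L n"] by simp
    also have "\<dots> = a" using \<open>0 < a\<close> e by (simp add: powr_powr)
    finally show "\<exists>n. 2 ^ n * L n powr (1 + e) < a" by blast
  qed (use e in \<open>auto simp: dist_real_def\<close>)
  then have "Hausdorff_dim (submetric euclidean_metric (range point)) \<le> ennreal (1 + e)"
    using e by (intro Hausdorff_dim_le) auto
  then show "Hausdorff_dim (submetric euclidean_metric (range point)) \<le> 1 + ennreal e"
    using e by (simp add: ennreal_plus)
qed

text \<open>
  If 2^n L n dropped below every multiple of e^(-\<epsilon> n), the coverings by intervals would make the
  s-dimensional measure vanish for the s with (1 - s) ln 2 = \<epsilon> s, which is less than 1.
\<close>
lemma length_ge_of_Hausdorff_dim_1:
  assumes dim: "Hausdorff_dim (submetric euclidean_metric (range point)) = 1" and \<epsilon>: "0 < \<epsilon>"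
  obtains C where "0 < C" "\<And>n. C * exp (- \<epsilon> * real n) \<le> 2 ^ n * L n"
proof (rule ccontr)
  assume "\<not> thesis"
  with that have no: "\<And>C. 0 < C \<Longrightarrow> \<exists>n. 2 ^ n * L n < C * exp (- \<epsilon> * real n)"
    by (meson not_le)
  define s where "s = ln 2 / (ln 2 + \<epsilon>)"
  have ln2: "(0::real) < ln 2" by simp
  have s: "0 < s" "s < 1" using \<epsilon> ln2 by (auto simp: s_def divide_simps add_pos_pos)
  have "0 < ln 2 + \<epsilon>" using \<epsilon> ln2 by linarith
  then have s_eq: "ln 2 * (1 - s) = \<epsilon> * s"
    by (simp add: s_def field_simps)
  have "Hausdorff_measure (submetric euclidean_metric (range point)) s = 0"
  proof (rule Hausdorff_measure_eq_0_of_range)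
    fix a :: real assume a: "0 < a"
    obtain n where n: "2 ^ n * L n < a powr (1 / s) * exp (- \<epsilon> * real n)"
      using no[of "a powr (1 / s)"] a by auto
    have two: "(2 :: real) ^ n = exp (ln 2 * n)"
      by (simp add: exp_of_nat_mult mult.commute)
    have "2 ^ n * L n powr s = exp (ln 2 * (1 - s) * n) * (exp (ln 2 * n) * L n) powr s"
      using pos[of n] by (simp add: powr_mult exp_powr_real two algebra_simps exp_add[symmetric])
    also have "\<dots> < exp (ln 2 * (1 - s) * n) * (a powr (1 / s) * exp (- \<epsilon> * real n)) powr s"
      using n s pos[of n] unfolding two
      by (intro mult_strict_left_mono powr_less_mono2) auto
    also have "\<dots> = a"
      unfolding s_eq using a s by (simp add: powr_mult powr_powr exp_powr_real exp_add[symmetric] algebra_simps)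
    finally show "\<exists>n. 2 ^ n * L n powr s < a" by blast
  qed (use s in \<open>auto simp: dist_real_def\<close>)
  then have "Hausdorff_dim (submetric euclidean_metric (range point)) \<le> ennreal s"
    using s by (intro Hausdorff_dim_le) auto
  with dim s show False by (simp add: ennreal_le_1 flip: ennreal_1)
qed

end

section \<open>Quasisymmetric maps of uniformly perfect spaces\<close>

lemma mdist_self: "x \<in> mspace X \<Longrightarrow> mdist X x x = 0"
  by simp

lemma mdist_le_0_imp_eq:
  assumes "x \<in> mspace X" "y \<in> mspace X" "mdist X x y \<le> 0"
  shows "x = y"
  using assms mdist_zero[of x X y] mdist_nonneg[of X x y] by linarith

lemma uniformly_perfect_obtain:
  assumes "uniformly_perfect X"
  obtains C where "C \<ge> 1"
    "\<And>y z r. y \<in> mspace X \<Longrightarrow> z \<in> mspace X \<Longrightarrow> 0 < r \<Longrightarrow> r \<le> mdist X y z \<Longrightarrow>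
      \<exists>u\<in>mspace X. r / C \<le> mdist X u y \<and> mdist X u y < r"
proof -
  obtain C where C: "C \<ge> 1" and up: "\<And>y r. y \<in> mspace X \<Longrightarrow> 0 < r \<Longrightarrow> mspace X - mball_of X y r \<noteq> {} \<Longrightarrow>
      mball_of X y r - mball_of X y (r / C) \<noteq> {}"
    using assms unfolding uniformly_perfect_def by blast
  have "\<exists>u\<in>mspace X. r / C \<le> mdist X u y \<and> mdist X u y < r"
    if A: "y \<in> mspace X" "z \<in> mspace X" "0 < r" "r \<le> mdist X y z" for y z r
  proof -
    have "z \<in> mspace X - mball_of X y r" using A by (auto simp: in_mball_of)
    then have "mball_of X y r - mball_of X y (r / C) \<noteq> {}" using up[of y r] A by blast
    then obtain u where "u \<in> mball_of X y r - mball_of X y (r / C)" by blast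
    then show ?thesis using A by (intro bexI[of _ u]) (auto simp: in_mball_of mdist_commute)
  qed
  with C that show ?thesis by blast
qed

text \<open>
  The multiplicative form of the definition, together with the one property of the homeomorphism
  that matters at small scales: it takes arbitrarily small values because it vanishes at 0. If it
  vanished at some u > 0 instead, then, being injective and continuous, it would be negative on one
  side of u.
\<close>
lemma quasisymmetric_obtain:
  assumes "quasisymmetric X Y F"
  obtains \<eta> :: "real \<Rightarrow> real" where
    "\<And>e. 0 < e \<Longrightarrow> \<exists>t. 0 < t \<and> t < 1 \<and> \<eta> t \<le> e"
    "\<And>x y z t. x \<in> mspace X \<Longrightarrow> y \<in> mspace X \<Longrightarrow> z \<in> mspace X \<Longrightarrow> 0 < t \<Longrightarrow> x \<noteq> y \<Longrightarrow> y \<noteq> z \<Longrightarrow> x \<noteq> z \<Longrightarrow>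
       mdist X x y \<le> t * mdist X y z \<Longrightarrow> mdist Y (F x) (F y) \<le> \<eta> t * mdist Y (F y) (F z)"
    "inj_on F (mspace X)" "F ` mspace X \<subseteq> mspace Y"
proof -
  obtain \<eta> \<theta> where hom: "homeomorphism {0..} {0..} \<eta> \<theta>" and qs: "eta_quasisymmetric \<eta> X Y F"
    using assms unfolding quasisymmetric_def by blast
  have homF: "homeomorphic_map (mtopology_of X) (subtopology (mtopology_of Y) (F ` mspace X)) F"
    using qs by (simp add: eta_quasisymmetric_def embedding_map_def)
  have inj: "inj_on F (mspace X)"
    using homeomorphic_imp_injective_map[OF homF] by simp
  have sub: "F ` mspace X \<subseteq> mspace Y"
    using homeomorphic_imp_surjective_map[OF homF]
    unfolding topspace_subtopology topspace_mtopology_of by blast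
  have cont: "continuous_on {0..} \<eta>" and img: "\<eta> ` {0..} = {0..}" and inje: "inj_on \<eta> {0..}"
    using hom by (auto simp: homeomorphism_def intro: inj_on_inverseI)
  have eta0: "\<eta> 0 = 0"
  proof (rule ccontr)
    assume ne: "\<eta> 0 \<noteq> 0"
    obtain u where u: "u \<ge> 0" "\<eta> u = 0" using imageE[of 0 \<eta> "{0..}"] img by auto
    with ne have "0 < u" by (cases "u = 0") auto
    then have "(\<eta> 0 < \<eta> u \<and> \<eta> u < \<eta> (u + 1)) \<or> (\<eta> (u + 1) < \<eta> u \<and> \<eta> u < \<eta> 0)"
      by (intro continuous_inj_imp_mono continuous_on_subset[OF cont] inj_on_subset[OF inje]) auto
    moreover have "\<eta> 0 \<ge> 0" "\<eta> (u + 1) \<ge> 0" using img u by (auto dest!: equalityD1 simp: image_subset_iff)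
    ultimately show False using u by auto
  qed
  show ?thesis
  proof (rule that[of \<eta>])
    fix e :: real assume e: "0 < e"
    obtain d where d: "0 < d" "\<And>t. t \<in> {0..} \<Longrightarrow> dist t 0 < d \<Longrightarrow> dist (\<eta> t) (\<eta> 0) < e"
      using cont[unfolded continuous_on_iff, rule_format, of 0 e] e by auto
    have "dist (\<eta> (min (1/2) (d / 2))) (\<eta> 0) < e"
      using d(1) by (intro d(2)) (auto simp: dist_real_def)
    then have "\<eta> (min (1/2) (d / 2)) \<le> e"
      using eta0 by (simp add: dist_real_def)
    then show "\<exists>t. 0 < t \<and> t < 1 \<and> \<eta> t \<le> e"
      using d by (intro exI[of _ "min (1/2) (d / 2)"]) auto
  next
    fix x y z t assume A: "x \<in> mspace X" "y \<in> mspace X" "z \<in> mspace X" "0 < t" "x \<noteq> y" "y \<noteq> z" "x \<noteq> z"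
       "mdist X x y \<le> t * mdist X y z"
    then have "0 < mdist X y z" by (simp add: order_less_le)
    then have "mdist X x y / mdist X y z \<le> t" using A by (simp add: divide_le_eq)
    then have *: "mdist Y (F x) (F y) / mdist Y (F y) (F z) \<le> \<eta> t"
      using qs A unfolding eta_quasisymmetric_def by blast
    have "F y \<noteq> F z" using inj A by (simp add: inj_on_eq_iff)
    then have "0 < mdist Y (F y) (F z)" using sub A by (simp add: order_less_le image_subset_iff)
    then show "mdist Y (F x) (F y) \<le> \<eta> t * mdist Y (F y) (F z)" using * by (simp add: divide_le_eq)
  qed (fact inj sub)+
qed

text \<open>
  Uniform perfectness at y gives a point u with d(u,y) less than half of d(x,y), but at least a fixed
  fraction of it. Passing from x to u costs one factor H, and after k such steps one arrives at the
  scale of d(y,z).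
\<close>
lemma quasisymmetric_growth:
  assumes "uniformly_perfect X" "quasisymmetric X Y F"
  obtains H where "1 \<le> H" "\<And>k x y z. x \<in> mspace X \<Longrightarrow> y \<in> mspace X \<Longrightarrow> z \<in> mspace X \<Longrightarrow>
    mdist X x y \<le> 2 ^ k * mdist X y z \<Longrightarrow> mdist Y (F x) (F y) \<le> H ^ Suc k * mdist Y (F y) (F z)"
proof -
  obtain C where C: "C \<ge> 1" and up: "\<And>y z r. y \<in> mspace X \<Longrightarrow> z \<in> mspace X \<Longrightarrow> 0 < r \<Longrightarrow> r \<le> mdist X y z \<Longrightarrow>
      \<exists>u\<in>mspace X. r / C \<le> mdist X u y \<and> mdist X u y < r"
    using uniformly_perfect_obtain[OF assms(1)] by blast
  obtain \<eta> :: "real \<Rightarrow> real" where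
    qs: "\<And>x y z t. x \<in> mspace X \<Longrightarrow> y \<in> mspace X \<Longrightarrow> z \<in> mspace X \<Longrightarrow> 0 < t \<Longrightarrow> x \<noteq> y \<Longrightarrow> y \<noteq> z \<Longrightarrow> x \<noteq> z \<Longrightarrow>
       mdist X x y \<le> t * mdist X y z \<Longrightarrow> mdist Y (F x) (F y) \<le> \<eta> t * mdist Y (F y) (F z)"
    and sub: "F ` mspace X \<subseteq> mspace Y"
    by (rule quasisymmetric_obtain[OF assms(2)]) blast
  define H where "H = max 1 (max (\<eta> 1) (\<eta> (2 * C)))"
  have H: "1 \<le> H" "\<eta> 1 \<le> H" "\<eta> (2 * C) \<le> H" by (auto simp: H_def)
  have FY: "F x \<in> mspace Y" if "x \<in> mspace X" for x using sub that by blast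
  have one: "mdist Y (F x) (F y) \<le> H * mdist Y (F y) (F z)"
    if A: "x \<in> mspace X" "y \<in> mspace X" "z \<in> mspace X" "mdist X x y \<le> mdist X y z" for x y z
  proof (cases "x = y \<or> x = z \<or> y = z")
    case True
    have "x = y" if "y = z"
    proof -
      have "mdist X x y \<le> 0" using A(4) mdist_self[OF A(2)] that by simp
      then show ?thesis using A by (intro mdist_le_0_imp_eq)
    qed
    with True have "x = y \<or> x = z" by auto
    then have "mdist Y (F x) (F y) \<le> 1 * mdist Y (F y) (F z)" using A FY by (auto simp: mdist_commute mdist_self)
    also have "\<dots> \<le> H * mdist Y (F y) (F z)" using H by (intro mult_right_mono) auto
    finally show ?thesis .
  next
    case False
    then have "mdist Y (F x) (F y) \<le> \<eta> 1 * mdist Y (F y) (F z)" using A by (intro qs) auto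
    also have "\<dots> \<le> H * mdist Y (F y) (F z)" using H by (intro mult_right_mono) auto
    finally show ?thesis .
  qed
  have "mdist Y (F x) (F y) \<le> H ^ Suc k * mdist Y (F y) (F z)"
    if "x \<in> mspace X" "y \<in> mspace X" "z \<in> mspace X" "mdist X x y \<le> 2 ^ k * mdist X y z" for k x y z
    using that
  proof (induction k arbitrary: x)
    case 0
    then show ?case using one by simp
  next
    case (Suc k)
    show ?case
    proof (cases "x = y")
      case True
      then show ?thesis using Suc.prems FY H by (simp add: mdist_self)
    next
      case False
      then have d: "0 < mdist X x y" using Suc.prems by (simp add: order_less_le)
      obtain u where u: "u \<in> mspace X" "mdist X x y / 2 / C \<le> mdist X u y" "mdist X u y < mdist X x y / 2"
        using up[of y x "mdist X x y / 2"] Suc.prems d by (auto simp: mdist_commute)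
      have "mdist Y (F u) (F y) \<le> H ^ Suc k * mdist Y (F y) (F z)"
        using Suc.prems u by (intro Suc.IH) auto
      moreover have "mdist Y (F x) (F y) \<le> H * mdist Y (F y) (F u)"
      proof -
        have "0 < mdist X x y / 2 / C" using d C by simp
        then have "u \<noteq> y" "u \<noteq> x" using u d Suc.prems by (auto simp: mdist_self)
        moreover have "mdist X x y \<le> 2 * C * mdist X y u"
          using u C d by (simp add: field_simps mdist_commute)
        ultimately have "mdist Y (F x) (F y) \<le> \<eta> (2 * C) * mdist Y (F y) (F u)"
          using Suc.prems u C False by (intro qs) auto
        also have "\<dots> \<le> H * mdist Y (F y) (F u)" using H by (intro mult_right_mono) auto
        finally show ?thesis .
      qed
      moreover have "H * mdist Y (F y) (F u) \<le> H * (H ^ Suc k * mdist Y (F y) (F z))"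
        if "mdist Y (F u) (F y) \<le> H ^ Suc k * mdist Y (F y) (F z)"
        using H(1) that by (intro mult_left_mono) (auto simp: mdist_commute)
      ultimately have "mdist Y (F x) (F y) \<le> H * (H ^ Suc k * mdist Y (F y) (F z))"
        by linarith
      then show ?thesis by (simp add: mult.assoc)
    qed
  qed
  with H(1) that show ?thesis by blast
qed

text \<open>
  Here z is moved towards y: uniform perfectness gives u with d(u,y) < t d(y,z) and at least a fixed
  fraction of it, and t is so small that the image distance is halved in each step.
\<close>
lemma quasisymmetric_decay:
  assumes "uniformly_perfect X" "quasisymmetric X Y F"
  obtains H q where "1 \<le> H" "0 < q" "q < 1" "\<And>k x y z. x \<in> mspace X \<Longrightarrow> y \<in> mspace X \<Longrightarrow> z \<in> mspace X \<Longrightarrow>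
    mdist X x y \<le> q ^ k * mdist X y z \<Longrightarrow> mdist Y (F x) (F y) \<le> H * (1/2) ^ k * mdist Y (F y) (F z)"
proof -
  obtain C where C: "C \<ge> 1" and up: "\<And>y z r. y \<in> mspace X \<Longrightarrow> z \<in> mspace X \<Longrightarrow> 0 < r \<Longrightarrow> r \<le> mdist X y z \<Longrightarrow>
      \<exists>u\<in>mspace X. r / C \<le> mdist X u y \<and> mdist X u y < r"
    using uniformly_perfect_obtain[OF assms(1)] by blast
  obtain \<eta> :: "real \<Rightarrow> real" where
    small: "\<And>e. 0 < e \<Longrightarrow> \<exists>t. 0 < t \<and> t < 1 \<and> \<eta> t \<le> e" and
    qs: "\<And>x y z t. x \<in> mspace X \<Longrightarrow> y \<in> mspace X \<Longrightarrow> z \<in> mspace X \<Longrightarrow> 0 < t \<Longrightarrow> x \<noteq> y \<Longrightarrow> y \<noteq> z \<Longrightarrow> x \<noteq> z \<Longrightarrow>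
       mdist X x y \<le> t * mdist X y z \<Longrightarrow> mdist Y (F x) (F y) \<le> \<eta> t * mdist Y (F y) (F z)"
    and sub: "F ` mspace X \<subseteq> mspace Y"
    by (rule quasisymmetric_obtain[OF assms(2)]) blast
  obtain H where H: "1 \<le> H" and growth: "\<And>k x y z. x \<in> mspace X \<Longrightarrow> y \<in> mspace X \<Longrightarrow> z \<in> mspace X \<Longrightarrow>
    mdist X x y \<le> 2 ^ k * mdist X y z \<Longrightarrow> mdist Y (F x) (F y) \<le> H ^ Suc k * mdist Y (F y) (F z)"
    using quasisymmetric_growth[OF assms] by blast
  obtain t where t: "0 < t" "t < 1" "\<eta> t \<le> 1/2" using small[of "1/2"] by auto
  define q where "q = t / C"
  have q: "0 < q" "q < 1" using t C by (auto simp: q_def divide_simps)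
  have FY: "F x \<in> mspace Y" if "x \<in> mspace X" for x using sub that by blast
  have "mdist Y (F x) (F y) \<le> H * (1/2) ^ k * mdist Y (F y) (F z)"
    if "x \<in> mspace X" "y \<in> mspace X" "z \<in> mspace X" "mdist X x y \<le> q ^ k * mdist X y z" for k x y z
    using that
  proof (induction k arbitrary: z)
    case 0
    then show ?case using growth[of x y z 0] by simp
  next
    case (Suc k)
    show ?case
    proof (cases "z = y")
      case True
      then have "mdist X x y \<le> 0" using Suc.prems(4) mdist_self[OF Suc.prems(2)] by simp
      then have "x = y" using Suc.prems by (intro mdist_le_0_imp_eq)
      then show ?thesis using mdist_self[OF FY[OF Suc.prems(2)]] True by simp
    next
      case False
      then have d: "0 < mdist X y z" using Suc.prems by (simp add: order_less_le)
      have "t * mdist X y z \<le> 1 * mdist X y z" using t by (intro mult_right_mono) auto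
      then obtain u where u: "u \<in> mspace X" "t * mdist X y z / C \<le> mdist X u y" "mdist X u y < t * mdist X y z"
        using up[of y z "t * mdist X y z"] Suc.prems d t by auto
      have "mdist X x y \<le> q ^ k * (t * mdist X y z / C)"
        using Suc.prems by (simp add: q_def field_simps)
      also have "\<dots> \<le> q ^ k * mdist X y u" using u q by (intro mult_left_mono) (auto simp: mdist_commute)
      finally have "mdist Y (F x) (F y) \<le> H * (1/2) ^ k * mdist Y (F y) (F u)"
        using Suc.prems u by (intro Suc.IH) auto
      moreover have "mdist Y (F u) (F y) \<le> 1/2 * mdist Y (F y) (F z)"
      proof -
        have "0 < t * mdist X y z / C" using d C t by simp
        moreover have "t * mdist X y z \<le> mdist X y z" using d t by simp
        ultimately have "u \<noteq> y" "u \<noteq> z" using u Suc.prems mdist_commute[of X y z] by (auto simp: mdist_self)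
        then have "mdist Y (F u) (F y) \<le> \<eta> t * mdist Y (F y) (F z)"
          using Suc.prems u t False by (intro qs) auto
        also have "\<dots> \<le> 1/2 * mdist Y (F y) (F z)" using t by (intro mult_right_mono) auto
        finally show ?thesis .
      qed
      then have "H * (1/2) ^ k * mdist Y (F y) (F u) \<le> H * (1/2) ^ k * (1/2 * mdist Y (F y) (F z))"
        using H by (intro mult_left_mono) (auto simp: mdist_commute)
      ultimately show ?thesis by simp
    qed
  qed
  with H q that show ?thesis by blast
qed

text \<open>
  Let T = d(x,y) / d(y,z). For T \<le> t with t small, the distortion is at most e^\<epsilon> - 1 and every
  K \<ge> 0 will do. For T > t, the bound H^(k+1) with k about log2(1+T) is a power of 1 + T, because 1 + T
  stays away from 1 and so a power of it also absorbs constant factors. The form of the bound makes it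
  multiplicative along the steps of the Cantor construction.
\<close>
lemma quasisymmetric_sum_bound:
  assumes "uniformly_perfect X" "quasisymmetric X Y F" and \<epsilon>: "0 < \<epsilon>"
  obtains K where "0 \<le> K" "\<And>x y z. x \<in> mspace X \<Longrightarrow> y \<in> mspace X \<Longrightarrow> z \<in> mspace X \<Longrightarrow> y \<noteq> z \<Longrightarrow>
    mdist Y (F x) (F y) + mdist Y (F y) (F z) \<le>
      exp \<epsilon> * (1 + mdist X x y / mdist X y z) powr K * mdist Y (F y) (F z)"
proof -
  obtain \<eta> :: "real \<Rightarrow> real" where
    small: "\<And>e. 0 < e \<Longrightarrow> \<exists>t. 0 < t \<and> t < 1 \<and> \<eta> t \<le> e" and
    qs: "\<And>x y z t. x \<in> mspace X \<Longrightarrow> y \<in> mspace X \<Longrightarrow> z \<in> mspace X \<Longrightarrow> 0 < t \<Longrightarrow> x \<noteq> y \<Longrightarrow> y \<noteq> z \<Longrightarrow> x \<noteq> z \<Longrightarrow>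
       mdist X x y \<le> t * mdist X y z \<Longrightarrow> mdist Y (F x) (F y) \<le> \<eta> t * mdist Y (F y) (F z)"
    and sub: "F ` mspace X \<subseteq> mspace Y"
    by (rule quasisymmetric_obtain[OF assms(2)]) blast
  obtain H where H: "1 \<le> H" and growth: "\<And>k x y z. x \<in> mspace X \<Longrightarrow> y \<in> mspace X \<Longrightarrow> z \<in> mspace X \<Longrightarrow>
    mdist X x y \<le> 2 ^ k * mdist X y z \<Longrightarrow> mdist Y (F x) (F y) \<le> H ^ Suc k * mdist Y (F y) (F z)"
    using quasisymmetric_growth[OF assms(1,2)] by blast
  obtain t where t: "0 < t" "t < 1" "\<eta> t \<le> exp \<epsilon> - 1" using small[of "exp \<epsilon> - 1"] \<epsilon> by auto
  \<comment> \<open>(1+T)^K = (1+H)^(log2(1+T) + 2 ln(1+T)/ln(1+t)), and the last quotient is at least 1 when T > t.\<close>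
  define K where "K = ln (1 + H) * (1 / ln 2 + 2 / ln (1 + t))"
  have K: "0 \<le> K" using H t by (simp add: K_def)
  have "mdist Y (F x) (F y) + mdist Y (F y) (F z) \<le>
      exp \<epsilon> * (1 + mdist X x y / mdist X y z) powr K * mdist Y (F y) (F z)"
    if A: "x \<in> mspace X" "y \<in> mspace X" "z \<in> mspace X" "y \<noteq> z" for x y z
  proof -
    define T where "T = mdist X x y / mdist X y z"
    have d: "0 < mdist X y z" using A by (simp add: order_less_le)
    have T: "0 \<le> T" using d by (simp add: T_def)
    have dT: "mdist X x y = T * mdist X y z" using d by (simp add: T_def)
    have one: "1 \<le> (1 + T) powr K" using T K by (intro ge_one_powr_ge_zero) auto
    have "mdist Y (F x) (F y) \<le> (exp \<epsilon> * (1 + T) powr K - 1) * mdist Y (F y) (F z)"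
    proof (cases "T \<le> t")
      case True
      have "1 * 1 \<le> exp \<epsilon> * (1 + T) powr K" using one \<epsilon> by (intro mult_mono) auto
      moreover have "mdist Y (F x) (F x) = 0" using sub A by (intro mdist_self) blast
      moreover have "mdist Y (F x) (F y) \<le> (exp \<epsilon> * (1 + T) powr K - 1) * mdist Y (F y) (F z)" if "x \<noteq> y"
      proof -
        have "T * mdist X y z < 1 * mdist X y z" using True t d by (intro mult_strict_right_mono) auto
        then have "x \<noteq> z" using dT mdist_commute[of X y z] by auto
        moreover have "mdist X x y \<le> t * mdist X y z" unfolding dT using True d by (intro mult_right_mono) auto
        ultimately have "mdist Y (F x) (F y) \<le> \<eta> t * mdist Y (F y) (F z)"
          using A that t by (intro qs) auto
        also have "\<dots> \<le> (exp \<epsilon> * 1 - 1) * mdist Y (F y) (F z)"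
          using t by (intro mult_right_mono) auto
        also have "\<dots> \<le> (exp \<epsilon> * (1 + T) powr K - 1) * mdist Y (F y) (F z)"
          using one by (intro mult_right_mono diff_right_mono mult_left_mono) auto
        finally show ?thesis .
      qed
      ultimately show ?thesis by (cases "x = y") auto
    next
      case False
      define k where "k = nat \<lceil>log 2 (1 + T)\<rceil>"
      have log: "0 \<le> log 2 (1 + T)" using T by simp
      have "1 + T = 2 powr log 2 (1 + T)" using T by simp
      also have "\<dots> \<le> 2 powr real k" unfolding k_def by (intro powr_mono) (use log in linarith, simp)
      also have "\<dots> = 2 ^ k" by (simp add: powr_realpow)
      finally have "T \<le> 2 ^ k" by simp
      then have "mdist X x y \<le> 2 ^ k * mdist X y z" unfolding dT using d by (intro mult_right_mono) auto
      then have "mdist Y (F x) (F y) \<le> H ^ Suc k * mdist Y (F y) (F z)" using A by (intro growth)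
      also have "\<dots> \<le> (exp \<epsilon> * (1 + T) powr K - 1) * mdist Y (F y) (F z)"
      proof (rule mult_right_mono)
        have k: "real (Suc k) \<le> ln (1 + T) / ln 2 + 2"
          using log unfolding k_def log_def by linarith
        have "ln (1 + t) \<le> ln (1 + T)" using False t by simp
        then have "1 \<le> ln (1 + T) / ln (1 + t)" using t by (simp add: divide_simps)
        then have "real (Suc k) \<le> ln (1 + T) / ln 2 + 2 * (ln (1 + T) / ln (1 + t))" using k by linarith
        also have "\<dots> = (1 / ln 2 + 2 / ln (1 + t)) * ln (1 + T)" by (simp add: algebra_simps)
        finally have "ln (1 + H) * real (Suc k) \<le> ln (1 + H) * ((1 / ln 2 + 2 / ln (1 + t)) * ln (1 + T))"
          using H by (intro mult_left_mono) auto
        then have "(1 + H) powr real (Suc k) \<le> (1 + T) powr K"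
          using H T by (simp add: powr_def K_def mult_ac)
        then have "(1 + H) ^ Suc k \<le> (1 + T) powr K" using H by (subst powr_realpow[symmetric]) auto
        moreover have "H ^ Suc k + 1 \<le> (1 + H) ^ Suc k"
        proof (induction k)
          case (Suc k)
          have "H ^ Suc (Suc k) + 1 \<le> (1 + H) * (H ^ Suc k + 1)"
            using H by (simp add: algebra_simps)
          also have "\<dots> \<le> (1 + H) * (1 + H) ^ Suc k"
            using H by (intro mult_left_mono Suc) auto
          finally show ?case by simp
        qed simp
        moreover have "1 * (1 + T) powr K \<le> exp \<epsilon> * (1 + T) powr K" using \<epsilon> by (intro mult_right_mono) auto
        ultimately show "H ^ Suc k \<le> exp \<epsilon> * (1 + T) powr K - 1" by linarith
      qed simp
      finally show ?thesis .
    qed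
    then show ?thesis unfolding T_def[symmetric] by (simp add: algebra_simps)
  qed
  with K that show ?thesis by blast
qed

section \<open>Quasisymmetric images of Cantor sets of dimension one\<close>

context halving_sequence begin

text \<open>
  The weight of a word w of length n is \<rho>(w) e^(\<epsilon> n) (2^n L n)^(-2K), with \<rho>(w) the distance of the
  images of its endpoints. Its subadditivity is \<open>quasisymmetric_sum_bound\<close> for the two
  endpoints of the gap and the left endpoint of w, combined with
  1 + gap n / L (n+1) = 2u - 1 \<le> u^2 for u = L n / (2 L (n+1)).
\<close>
lemma Hausdorff_dim_quasisymmetric_image_ge_1:
  fixes X :: "'a metric" and Y :: "'b metric"
  assumes L0: "L 0 = 1"
    and dim: "Hausdorff_dim (submetric euclidean_metric (range point)) = 1"
    and up: "uniformly_perfect X"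
    and iso: "isometric_embedding (submetric euclidean_metric (range point)) X \<iota>"
    and qs: "quasisymmetric X Y F" and f: "\<And>x. x \<in> range point \<Longrightarrow> F (\<iota> x) = f x"
  shows "1 \<le> Hausdorff_dim (submetric Y (f ` range point))"
proof (rule Hausdorff_dim_greatest)
  fix s :: real assume s: "0 < s" and null: "Hausdorff_measure (submetric Y (f ` range point)) s = 0"
  define \<rho> where "\<rho> x y = mdist Y (f x) (f y)" for x y
  have \<rho>_commute: "\<rho> x y = \<rho> y x" and \<rho>_nonneg: "0 \<le> \<rho> x y" for x y
    by (simp_all add: \<rho>_def mdist_commute)
  have \<iota>: "\<iota> x \<in> mspace X" if "x \<in> range point" for x
    using iso that by (auto simp: isometric_embedding_def)
  have d\<iota>: "mdist X (\<iota> x) (\<iota> y) = \<bar>x - y\<bar>" if "x \<in> range point" "y \<in> range point" for x y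
    using iso that by (auto simp: isometric_embedding_def dist_real_def)
  have \<rho>F: "\<rho> x y = mdist Y (F (\<iota> x)) (F (\<iota> y))" if "x \<in> range point" "y \<in> range point" for x y
    using f that by (simp add: \<rho>_def)
  obtain inj: "inj_on F (mspace X)" and sub: "F ` mspace X \<subseteq> mspace Y"
    by (rule quasisymmetric_obtain[OF qs]) blast
  have fY: "f x \<in> mspace Y" if "x \<in> range point" for x
    using sub \<iota>[OF that] f[OF that] by (metis image_subset_iff)
  then have Z: "mspace (submetric Y (f ` range point)) = f ` range point" by auto
  have triangle: "\<rho> x z \<le> \<rho> x y + \<rho> y z"
    if "x \<in> range point" "y \<in> range point" "z \<in> range point" for x y z
    unfolding \<rho>_def using that by (intro mdist_triangle fY)
  have ends: "left_end [] = 0" "right_end [] = 1"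
    using right_end_minus_left_end[of "[]"] L0 by (simp_all add: point_def extend_def)
  have bounds: "0 \<le> x" "x \<le> 1" if "x \<in> range point" for x
    using that point_between[of _ 0] ends by (auto simp: initial_def)
  have mem: "0 \<in> range point" "1 \<in> range point"
    using ends by (metis rangeI)+

  obtain H where H: "1 \<le> H" and growth: "\<And>k x y z. x \<in> mspace X \<Longrightarrow> y \<in> mspace X \<Longrightarrow> z \<in> mspace X \<Longrightarrow>
    mdist X x y \<le> 2 ^ k * mdist X y z \<Longrightarrow> mdist Y (F x) (F y) \<le> H ^ Suc k * mdist Y (F y) (F z)"
    using quasisymmetric_growth[OF up qs] by blast
  have growth': "\<rho> x y \<le> H ^ Suc k * \<rho> y z" if "x \<in> range point" "y \<in> range point" "z \<in> range point"
    "\<bar>x - y\<bar> \<le> 2 ^ k * \<bar>y - z\<bar>" for k x y z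
    using that growth[of "\<iota> x" "\<iota> y" "\<iota> z" k] by (simp add: \<rho>F \<iota> d\<iota>)
  define M where "M = 2 * (H * \<rho> 0 1)"
  have M: "\<rho> x y \<le> M" if "x \<in> range point" "y \<in> range point" for x y
    using growth'[of x 0 1 0] growth'[of y 0 1 0] triangle[of x 0 y] that mem bounds[of x] bounds[of y]
    by (simp add: M_def \<rho>_commute[of 0 y])

  obtain H' q where H': "1 \<le> H'" and q: "0 < q" "q < 1"
    and decay: "\<And>k x y z. x \<in> mspace X \<Longrightarrow> y \<in> mspace X \<Longrightarrow> z \<in> mspace X \<Longrightarrow>
    mdist X x y \<le> q ^ k * mdist X y z \<Longrightarrow> mdist Y (F x) (F y) \<le> H' * (1/2) ^ k * mdist Y (F y) (F z)"
    using quasisymmetric_decay[OF up qs] by blast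
  \<comment> \<open>N halvings of the length make up for one factor q, so the bound for \<rho>(w) is halved every N steps.\<close>
  obtain N where N: "(1/2) ^ N < q" using real_arch_pow_inv[of q "1/2"] q by auto
  have N0: "0 < N" using N q by (cases N) auto
  define \<mu> where "\<mu> = ln 2 / real N"
  have \<mu>: "0 < \<mu>" using N0 by (simp add: \<mu>_def)
  have diam_decay: "\<rho> (left_end w) (right_end w) \<le> 2 * (H' * M) * exp (- \<mu> * length w)" for w
  proof -
    define n where "n = length w"
    define k where "k = (n - 1) div N"
    have E: "left_end w \<in> range point" "right_end w \<in> range point" by auto
    have M0: "0 \<le> M" using M[OF E] \<rho>_nonneg order_trans by blast
    have "\<rho> (left_end w) (right_end w) \<le> H' * (1/2) ^ k * M"
    proof (cases "n = 0")
      case True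
      then have "k = 0" by (simp add: k_def)
      moreover have "1 * M \<le> H' * M" using H' M0 by (intro mult_right_mono)
      ultimately show ?thesis using M[OF E] by simp
    next
      case False
      \<comment> \<open>A reference point at distance at least 1/2; this factor is why k has n - 1 instead of n.\<close>
      obtain z where z: "z \<in> range point" "1/2 \<le> \<bar>left_end w - z\<bar>"
        using mem by (cases "left_end w \<le> 1/2") (auto intro: that[of 0] that[of 1])
      have "\<bar>right_end w - left_end w\<bar> \<le> (1/2) ^ n"
        using right_end_minus_left_end[of w] pos[of n] L_le[of n] L0 by (simp add: n_def power_divide)
      also have "(1/2 :: real) ^ n = (1/2) ^ (n - 1) * (1/2)" using False by (cases n) auto
      also have "(1/2 :: real) ^ (n - 1) \<le> (1/2) ^ (N * k)"
        by (intro power_decreasing) (auto simp: k_def)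
      also have "\<dots> = ((1/2) ^ N) ^ k" by (simp add: power_mult)
      also have "\<dots> \<le> q ^ k" using N by (intro power_mono) auto
      also have "q ^ k * (1/2) \<le> q ^ k * \<bar>left_end w - z\<bar>" using z q by (intro mult_left_mono) auto
      finally have "\<bar>right_end w - left_end w\<bar> \<le> q ^ k * \<bar>left_end w - z\<bar>" by simp
      then have "\<rho> (right_end w) (left_end w) \<le> H' * (1/2) ^ k * \<rho> (left_end w) z"
        using z decay[of "\<iota> (right_end w)" "\<iota> (left_end w)" "\<iota> z" k] by (simp add: \<rho>F \<iota> d\<iota>)
      also have "\<dots> \<le> H' * (1/2) ^ k * M" using z H' M by (intro mult_left_mono) auto
      finally show ?thesis by (simp add: \<rho>_commute)
    qed
    also have "\<dots> \<le> H' * (2 * exp (- \<mu> * n)) * M"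
    proof -
      have "n \<le> N * k + N"
        using mult_div_mod_eq[of N "n - 1"] mod_less_divisor[OF N0, of "n - 1"] unfolding k_def by linarith
      then have "real n \<le> real N * real k + real N" by (metis of_nat_add of_nat_le_iff of_nat_mult)
      then have "real n / real N \<le> (real N * real k + real N) / real N" by (intro divide_right_mono) auto
      then have "real n / real N \<le> real k + 1" using N0 by (simp add: add_divide_distrib)
      then have "ln 2 * (real n / real N) \<le> ln 2 * (real k + 1)" by (intro mult_left_mono) auto
      then have "exp (- ln 2 * real k) \<le> exp (ln 2 - \<mu> * n)" by (simp add: \<mu>_def algebra_simps)
      also have "\<dots> = 2 * exp (- \<mu> * n)" by (simp add: exp_diff exp_minus field_simps)
      finally have "exp (- ln 2) ^ k \<le> 2 * exp (- \<mu> * n)" by (simp only: exp_of_nat2_mult)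
      then have "(1/2) ^ k \<le> 2 * exp (- \<mu> * n)" by (simp add: exp_minus)
      then show ?thesis using H' M0 by (intro mult_right_mono mult_left_mono) auto
    qed
    finally show ?thesis by (simp add: n_def mult_ac)
  qed

  show "1 \<le> ennreal s"
  proof (rule ccontr)
    assume "\<not> 1 \<le> ennreal s"
    then have s1: "s < 1" by (meson ennreal_ge_1 not_le)
    \<comment> \<open>The loss e^(2 \<epsilon> n) in the weight is then exactly compensated by \<rho>(w)^(1-s).\<close>
    define \<epsilon> where "\<epsilon> = \<mu> * (1 - s) / 2"
    have \<epsilon>: "0 < \<epsilon>" using \<mu> s1 by (simp add: \<epsilon>_def)
    obtain K where K: "0 \<le> K" and sum_bound: "\<And>x y z. x \<in> mspace X \<Longrightarrow> y \<in> mspace X \<Longrightarrow> z \<in> mspace X \<Longrightarrow> y \<noteq> z \<Longrightarrow>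
      mdist Y (F x) (F y) + mdist Y (F y) (F z) \<le>
      exp \<epsilon> * (1 + mdist X x y / mdist X y z) powr K * mdist Y (F y) (F z)"
      using quasisymmetric_sum_bound[OF up qs \<epsilon>] by blast
    define P where "P n = 2 ^ n * L n" for n
    have P: "0 < P n" for n using pos by (simp add: P_def)
    \<comment> \<open>The rate is divided by 2K + 1 so that the power -2K of the total length costs at most e^(\<epsilon> n).\<close>
    obtain c where c: "0 < c" "\<And>n. c * exp (- (\<epsilon> / (2 * K + 1)) * real n) \<le> P n"
      using length_ge_of_Hausdorff_dim_1[OF dim, of "\<epsilon> / (2 * K + 1)"] \<epsilon> K unfolding P_def by auto
    define m where "m w = \<rho> (left_end w) (right_end w) * exp (\<epsilon> * length w) * P (length w) powr (- (2 * K))" for w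
    have "Hausdorff_measure (submetric Y (f ` range point)) s \<noteq> 0"
    proof (rule Hausdorff_measure_neq_0[where f = f and H = "H ^ 2" and m = m and
          C = "(2 * (H' * M) + 1) powr (1 - s) * c powr (- (2 * K))"])
      show le: "m w \<le> (2 * (H' * M) + 1) powr (1 - s) * c powr (- (2 * K)) *
         mdist (submetric Y (f ` range point)) (f (left_end w)) (f (right_end w)) powr s" for w
      proof -
        define D where "D = \<rho> (left_end w) (right_end w)"
        define n where "n = length w"
        have D0: "0 \<le> D" using \<rho>_nonneg by (simp add: D_def)
        have D_eq: "D = D powr (1 - s) * D powr s" using D0 by (simp add: powr_add[symmetric])
        have "D powr (1 - s) \<le> ((2 * (H' * M) + 1) * exp (- \<mu> * n)) powr (1 - s)"
        proof (rule powr_mono2)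
          show "D \<le> (2 * (H' * M) + 1) * exp (- \<mu> * n)"
            using diam_decay[of w] exp_ge_zero[of "- \<mu> * n"]
            unfolding D_def n_def distrib_right by linarith
        qed (use s1 D0 in auto)
        also have "((2 * (H' * M) + 1) * exp (- \<mu> * n)) powr (1 - s) =
            (2 * (H' * M) + 1) powr (1 - s) * exp (- 2 * \<epsilon> * n)"
        proof -
          have "- \<mu> * real n * (1 - s) = - 2 * \<epsilon> * n" by (simp add: \<epsilon>_def)
          then show ?thesis unfolding powr_mult exp_powr_real by (rule arg_cong)
        qed
        finally have "D powr (1 - s) * D powr s \<le> (2 * (H' * M) + 1) powr (1 - s) * exp (- 2 * \<epsilon> * n) * D powr s"
          by (intro mult_right_mono) auto
        moreover have "P n powr (- (2 * K)) \<le> c powr (- (2 * K)) * exp (\<epsilon> * n)"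
        proof -
          have "P n powr (- (2 * K)) \<le> (c * exp (- (\<epsilon> / (2 * K + 1)) * n)) powr (- (2 * K))"
            using c(1) c(2)[of n] K by (intro powr_mono2') auto
          also have "\<dots> = c powr (- (2 * K)) * exp ((2 * K) / (2 * K + 1) * (\<epsilon> * n))"
            using c(1) by (simp add: powr_mult exp_powr_real mult_ac)
          also have "\<dots> \<le> c powr (- (2 * K)) * exp (\<epsilon> * n)"
          proof (intro mult_left_mono)
            have "(2 * K) / (2 * K + 1) * (\<epsilon> * n) \<le> 1 * (\<epsilon> * n)"
              using K \<epsilon> by (intro mult_right_mono) auto
            then show "exp ((2 * K) / (2 * K + 1) * (\<epsilon> * n)) \<le> exp (\<epsilon> * n)" by simp
          qed auto
          finally show ?thesis .
        qed
        ultimately have "D * exp (\<epsilon> * n) * P n powr (- (2 * K)) \<le>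
           ((2 * (H' * M) + 1) powr (1 - s) * exp (- 2 * \<epsilon> * n) * D powr s) * exp (\<epsilon> * n) *
           (c powr (- (2 * K)) * exp (\<epsilon> * n))"
          unfolding D_eq[symmetric] using D0 by (intro mult_mono mult_nonneg_nonneg) auto
        also have "\<dots> = (2 * (H' * M) + 1) powr (1 - s) * c powr (- (2 * K)) * D powr s *
            (exp (- 2 * \<epsilon> * n) * exp (\<epsilon> * n) * exp (\<epsilon> * n))"
          by (simp only: mult_ac)
        also have "exp (- 2 * \<epsilon> * n) * exp (\<epsilon> * n) * exp (\<epsilon> * n) = 1"
          by (simp add: exp_add[symmetric])
        finally show ?thesis by (simp add: m_def D_def n_def \<rho>_def)
      qed
      show "\<exists>n. \<forall>w. length w = n \<longrightarrow> m w < e" if e: "0 < e" for e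
      proof -
        let ?C = "(2 * (H' * M) + 1) powr (1 - s) * c powr (- (2 * K))"
        have "(\<lambda>n. ?C * (2 * (H' * M) * exp (- \<mu> * real n)) powr s) \<longlonglongrightarrow> ?C * 0"
        proof (intro tendsto_mult tendsto_const)
          have "(\<lambda>n. exp (- \<mu>) ^ n) \<longlonglongrightarrow> 0" using \<mu> by (intro LIMSEQ_power_zero) simp
          then have "(\<lambda>n. exp (- \<mu> * real n)) \<longlonglongrightarrow> 0" by (simp only: exp_of_nat2_mult)
          then have "(\<lambda>n. 2 * (H' * M) * exp (- \<mu> * real n)) \<longlonglongrightarrow> 0" by (rule tendsto_mult_right_zero)
          then show "(\<lambda>n. (2 * (H' * M) * exp (- \<mu> * real n)) powr s) \<longlonglongrightarrow> 0"
            using s H' M[OF mem] \<rho>_nonneg[of 0 1] by (intro tendsto_zero_powrI[where b = s] tendsto_const) auto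
        qed
        then obtain n where n: "?C * (2 * (H' * M) * exp (- \<mu> * real n)) powr s < e"
          using order_tendstoD(2)[of _ "?C * 0" sequentially e] e by (auto simp: eventually_sequentially)
        have "m w < e" if "length w = n" for w
        proof -
          have "m w \<le> ?C * \<rho> (left_end w) (right_end w) powr s" using le[of w] by (simp add: \<rho>_def)
          also have "\<dots> \<le> ?C * (2 * (H' * M) * exp (- \<mu> * real n)) powr s"
            using diam_decay[of w] that s \<rho>_nonneg by (intro mult_left_mono powr_mono2) auto
          also have "\<dots> < e" by (rule n)
          finally show ?thesis .
        qed
        then show ?thesis by blast
      qed
      show "m w \<le> m (w @ [False]) + m (w @ [True])" for w
      proof -
        define n where "n = length w"
        define a b where "a = left_end w" and "b = right_end w"
        define a' b' where "a' = left_end (w @ [True])" and "b' = right_end (w @ [False])"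
        have E: "a \<in> range point" "b \<in> range point" "a' \<in> range point" "b' \<in> range point"
          by (auto simp: a_def b_def a'_def b'_def)
        have diffs: "b' - a = L (Suc n)" "a' - b' = gap n"
          using right_end_minus_left_end[of "w @ [False]"] left_end_snoc_True[of w]
          by (simp_all add: n_def a_def b_def a'_def b'_def)
        have neq: "\<iota> b' \<noteq> \<iota> a" using diffs pos[of "Suc n"] d\<iota>[of b' a] E \<iota> by (auto simp: mdist_self)
        define G where "G = exp \<epsilon> * (1 + gap n / L (Suc n)) powr K"
        have "\<rho> a' b' + \<rho> b' a \<le> G * \<rho> b' a"
          using sum_bound[of "\<iota> a'" "\<iota> b'" "\<iota> a"] E \<iota> neq diffs gap_nonneg[of n] pos[of "Suc n"]
          by (simp add: \<rho>F d\<iota> G_def)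
        moreover have "1 * 1 \<le> G"
          unfolding G_def using \<epsilon> K gap_nonneg[of n] pos[of "Suc n"]
          by (intro mult_mono ge_one_powr_ge_zero) auto
        then have "1 * \<rho> a' b \<le> G * \<rho> a' b" using \<rho>_nonneg by (intro mult_right_mono) auto
        moreover have "\<rho> a b \<le> \<rho> a b' + (\<rho> b' a' + \<rho> a' b)"
          using triangle[of a b' b] triangle[of b' a' b] E by simp
        ultimately have D: "\<rho> a b \<le> G * (\<rho> a b' + \<rho> a' b)"
          by (simp add: \<rho>_commute[of b' a] \<rho>_commute[of b' a'] algebra_simps)
        have G: "G \<le> exp \<epsilon> * (P n powr (2 * K) * P (Suc n) powr (- (2 * K)))"
        proof -
          define u where "u = P n / P (Suc n)"
          have u: "0 < u" using P by (simp add: u_def)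
          have "1 + gap n / L (Suc n) = 2 * u - 1"
            using pos[of n] pos[of "Suc n"] by (simp add: u_def P_def gap_def field_simps)
          also have "\<dots> \<le> u ^ 2" using zero_le_power2[of "u - 1"] by (simp add: power2_eq_square algebra_simps)
          finally have "(1 + gap n / L (Suc n)) powr K \<le> (u ^ 2) powr K"
            using K gap_nonneg[of n] pos[of "Suc n"] by (intro powr_mono2) auto
          also have "\<dots> = u powr (2 * K)" using u by (simp add: powr_powr[symmetric] powr_numeral)
          also have "\<dots> = P n powr (2 * K) * P (Suc n) powr (- (2 * K))"
            using P by (simp add: u_def powr_divide powr_minus_divide less_imp_le)
          finally show ?thesis unfolding G_def by (intro mult_left_mono) auto
        qed
        have "m w = \<rho> a b * (exp (\<epsilon> * n) * P n powr (- (2 * K)))"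
          by (simp add: m_def a_def b_def n_def)
        also have "\<dots> \<le> (exp \<epsilon> * (P n powr (2 * K) * P (Suc n) powr (- (2 * K))) * (\<rho> a b' + \<rho> a' b)) *
            (exp (\<epsilon> * n) * P n powr (- (2 * K)))"
          using D G \<rho>_nonneg[of a b'] \<rho>_nonneg[of a' b]
          by (intro mult_right_mono order_trans[OF D]) auto
        also have "\<dots> = (\<rho> a b' + \<rho> a' b) * ((exp \<epsilon> * exp (\<epsilon> * n)) * P (Suc n) powr (- (2 * K))) *
            (P n powr (2 * K) * P n powr (- (2 * K)))"
          by (simp only: mult_ac)
        also have "P n powr (2 * K) * P n powr (- (2 * K)) = 1"
          using P[of n] by (simp add: powr_add[symmetric])
        also have "exp \<epsilon> * exp (\<epsilon> * n) = exp (\<epsilon> * Suc n)"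
          by (simp add: exp_add[symmetric] algebra_simps)
        also have "(\<rho> a b' + \<rho> a' b) * (exp (\<epsilon> * Suc n) * P (Suc n) powr (- (2 * K))) * 1 =
            m (w @ [False]) + m (w @ [True])"
          by (simp add: m_def a_def b_def a'_def b'_def n_def algebra_simps)
        finally show ?thesis .
      qed
      have "\<iota> 0 \<noteq> \<iota> 1" using d\<iota>[OF mem] \<iota>[OF mem(1)] by (auto simp: mdist_self)
      then have "F (\<iota> 0) \<noteq> F (\<iota> 1)" using inj \<iota> mem by (simp add: inj_on_eq_iff)
      then have "0 < \<rho> 0 1" using \<rho>F[OF mem] sub \<iota> mem by (simp add: order_less_le image_subset_iff)
      then show "0 < m []" using P[of 0] by (simp add: m_def ends)
      show "0 \<le> m w" for w using \<rho>_nonneg by (simp add: m_def)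
      show "0 < (2 * (H' * M) + 1) powr (1 - s) * c powr (- (2 * K))"
      proof -
        have "0 \<le> H' * M" using H' M[OF mem] \<rho>_nonneg[of 0 1] by (intro mult_nonneg_nonneg) linarith+
        then show ?thesis using c by simp
      qed
      show "mdist (submetric Y (f ` range point)) (f x) (f y) \<le> H ^ 2 * mdist (submetric Y (f ` range point)) (f y) (f z)"
        if "x \<in> range point" "y \<in> range point" "z \<in> range point" "\<bar>x - y\<bar> \<le> 2 * \<bar>y - z\<bar>" for x y z
        using growth'[of x y z 1] that by (simp add: \<rho>_def power2_eq_square)
      show "mspace (submetric Y (f ` range point)) = f ` range point" by (rule Z)
      show "1 \<le> H ^ 2" using H by simp
    qed (rule s)
    with null show False by simp
  qed
qed

end

section \<open>A quasisymmetric map that shortens intervals with large gaps\<close>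

context halving_sequence begin

lemma step_le_point:
  assumes "\<sigma> j"
  shows "L j - L (Suc j) \<le> point \<sigma>"
proof -
  have s: "summable (\<lambda>k. of_bool (\<sigma> k) * (L k - L (Suc k)))"
    using weighted_summable[of "\<lambda>k. of_bool (\<sigma> k)" 1 0] by simp
  have "(\<Sum>k\<in>{j}. of_bool (\<sigma> k) * (L k - L (Suc k))) \<le> point \<sigma>"
    unfolding point_def using less_imp_le[OF step_pos] by (intro sum_le_suminf s) auto
  then show ?thesis using assms by simp
qed

text \<open>
  Look from the point 0 at the leftmost interval of level n: its right child begins at distance
  L n - L (n+1), and all points of E closer to 0 are in the left child, hence within L (n+1).
\<close>
lemma uniformly_perfect_imp_ratio:
  assumes L0: "L 0 = 1" and up: "uniformly_perfect (submetric euclidean_metric (range point))"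
  obtains \<kappa> where "0 < \<kappa>" "\<And>n. \<kappa> * L n \<le> L (Suc n)"
proof -
  obtain C where C: "C \<ge> 1"
    and up: "\<And>y z r. y \<in> range point \<Longrightarrow> z \<in> range point \<Longrightarrow> 0 < r \<Longrightarrow> r \<le> \<bar>y - z\<bar> \<Longrightarrow>
      \<exists>u\<in>range point. r / C \<le> \<bar>u - y\<bar> \<and> \<bar>u - y\<bar> < r"
    using uniformly_perfect_obtain[OF up] by (auto simp: dist_real_def)
  have ends: "left_end [] = 0" "right_end [] = 1"
    using right_end_minus_left_end[of "[]"] L0 by (simp_all add: point_def extend_def)
  have mem: "0 \<in> range point" "1 \<in> range point"
    using ends by (metis rangeI)+
  have "1 / (C + 1) * L n \<le> L (Suc n)" for n
  proof -
    have "L n - L (Suc n) \<le> 1" using antimono[of 0 n] L0 pos[of "Suc n"] by simp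
    then obtain u where u: "u \<in> range point" "(L n - L (Suc n)) / C \<le> \<bar>u\<bar>" "\<bar>u\<bar> < L n - L (Suc n)"
      using up[of 0 1 "L n - L (Suc n)"] mem step_pos[of n] by auto
    obtain \<sigma> where \<sigma>: "u = point \<sigma>" using u by auto
    have "\<not> \<sigma> j" if "j \<le> n" for j
    proof
      assume "\<sigma> j"
      then have "L j - L (Suc j) \<le> u" unfolding \<sigma> by (rule step_le_point)
      moreover have "L n - L (Suc n) \<le> L j - L (Suc j)"
      proof (cases "j = n")
        case False
        then show ?thesis using antimono[of "Suc j" n] half[of j] pos[of "Suc n"] that by simp
      qed simp
      ultimately show False using u by linarith
    qed
    then have "\<bar>point \<sigma> - left_end []\<bar> \<le> L (Suc n)"
      by (intro point_dist_le) (auto simp: extend_def)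
    then have "(L n - L (Suc n)) / C \<le> L (Suc n)" using u \<sigma> ends by simp
    then show ?thesis using C by (simp add: field_simps)
  qed
  then show ?thesis using C by (intro that[of "1 / (C + 1)"]) auto
qed

end

text \<open>
  Steps whose gap has relative length at least \<delta> are called big. The map constructed here shrinks
  intervals, relative to their original lengths and up to bounded factors, by 1/2 at each big step and
  by nothing at the others. Small gaps may occur at much smaller scales than the interval from which they are
  removed, and must be scaled according to their own length; therefore the factor is attached to a
  scale t instead of a step.
\<close>
locale compression = halving_sequence +
  fixes \<kappa> \<delta> :: real
  assumes \<kappa>: "0 < \<kappa>" "\<kappa> * L n \<le> L (Suc n)" and \<delta>: "0 < \<delta>" "\<delta> < 1"
    and ex_big: "\<exists>i\<ge>n. \<delta> * L i \<le> gap i"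
begin

definition big :: "nat set" where "big = {i. \<delta> * L i \<le> gap i}"

definition weight :: "real \<Rightarrow> real" where
  "weight t = (1/2) ^ card {i \<in> big. t \<le> L (Suc i)}"

definition \<phi> :: "real \<Rightarrow> real" where "\<phi> t = t * weight t"

lemma finite_levels: "0 < t \<Longrightarrow> finite {i \<in> big. t \<le> L (Suc i)}"
proof -
  assume "0 < t"
  then obtain n where n: "L n < t" using ex_less by blast
  have "{i \<in> big. t \<le> L (Suc i)} \<subseteq> {..<n}"
  proof
    fix i assume "i \<in> {i \<in> big. t \<le> L (Suc i)}"
    then have "L n < L (Suc i)" using n by simp
    then show "i \<in> {..<n}" using less_iff[of n "Suc i"] by simp
  qed
  then show ?thesis by (rule finite_subset) simp
qed

lemma weight_pos: "0 < weight t" and weight_le_1: "weight t \<le> 1"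
  by (simp_all add: weight_def power_le_one)

lemma weight_mono: "0 < s \<Longrightarrow> s \<le> t \<Longrightarrow> weight s \<le> weight t"
  unfolding weight_def by (intro power_decreasing card_mono finite_levels) auto

text \<open>Lengths are at least halved in each step, so at most one of them lies in [s, 2s).\<close>
lemma weight_double: "0 < s \<Longrightarrow> weight (2 * s) \<le> 2 * weight s"
proof -
  assume s: "0 < s"
  let ?A = "{i. s \<le> L (Suc i) \<and> L (Suc i) < 2 * s}"
  have one: "i = j" if "i \<in> ?A" "j \<in> ?A" "i \<le> j" for i j
  proof (rule ccontr)
    assume "i \<noteq> j"
    then have "L (Suc j) \<le> L (Suc (Suc i))" using that by (intro antimono) auto
    then show False using half[of "Suc i"] that by auto
  qed
  have card: "finite ?A \<and> card ?A \<le> 1"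
  proof (cases "?A = {}")
    case True
    then show ?thesis by (simp only: finite.emptyI card.empty) simp
  next
    case False
    then obtain i where "i \<in> ?A" by blast
    then have "?A = {i}" using one by (metis (mono_tags, lifting) nat_le_linear singletonI subsetI subset_antisym singletonD empty_subsetI insert_subset)
    then show ?thesis by simp
  qed
  have "card {i \<in> big. s \<le> L (Suc i)} \<le> card ({i \<in> big. 2 * s \<le> L (Suc i)} \<union> ?A)"
    using s card by (intro card_mono finite_UnI finite_levels) auto
  also have "\<dots> \<le> card {i \<in> big. 2 * s \<le> L (Suc i)} + card ?A" by (rule card_Un_le)
  also have "\<dots> \<le> Suc (card {i \<in> big. 2 * s \<le> L (Suc i)})" using card by simp
  finally have "(1/2 :: real) ^ Suc (card {i \<in> big. 2 * s \<le> L (Suc i)}) \<le> (1/2) ^ card {i \<in> big. s \<le> L (Suc i)}"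
    by (intro power_decreasing) auto
  then show ?thesis by (simp add: weight_def)
qed

lemma \<phi>_0 [simp]: "\<phi> 0 = 0"
  by (simp add: \<phi>_def)

lemma \<phi>_nonneg: "0 \<le> t \<Longrightarrow> 0 \<le> \<phi> t"
  using weight_pos[of t] by (simp add: \<phi>_def)

lemma \<phi>_pos: "0 < t \<Longrightarrow> 0 < \<phi> t"
  using weight_pos[of t] by (simp add: \<phi>_def)

lemma \<phi>_le_weight: "0 \<le> s \<Longrightarrow> s \<le> t \<Longrightarrow> \<phi> s \<le> s * weight t"
  unfolding \<phi>_def using weight_mono[of s t] by (cases "s = 0") (auto intro: mult_left_mono)

lemma \<phi>_le: "0 \<le> t \<Longrightarrow> \<phi> t \<le> t"
  using mult_left_mono[OF weight_le_1[of t], of t] by (simp add: \<phi>_def)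

lemma \<phi>_mono: "0 \<le> s \<Longrightarrow> s \<le> t \<Longrightarrow> \<phi> s \<le> \<phi> t"
  using order_trans[OF \<phi>_le_weight[of s t] mult_right_mono[of s t "weight t"]] weight_pos[of t]
  by (simp add: \<phi>_def[of t])

lemma \<phi>_scale:
  assumes "0 \<le> t" "0 \<le> s"
  shows "\<phi> (t * s) \<le> (t + 4 * t ^ 2) * \<phi> s"
proof (cases "t \<le> 1")
  case True
  then have "\<phi> (t * s) \<le> t * s * weight s"
    using assms mult_right_mono[of t 1 s] by (intro \<phi>_le_weight) auto
  also have "\<dots> = t * \<phi> s" by (simp add: \<phi>_def)
  also have "\<dots> \<le> (t + 4 * t ^ 2) * \<phi> s" using \<phi>_nonneg[of s] assms by (intro mult_right_mono) auto
  finally show ?thesis .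
next
  case False
  have pow: "\<phi> (2 ^ k * s) \<le> 4 ^ k * \<phi> s" for k
  proof (induction k)
    case (Suc k)
    have "\<phi> (2 * (2 ^ k * s)) \<le> 4 * \<phi> (2 ^ k * s)"
    proof (cases "s = 0")
      case False
      then have "weight (2 * (2 ^ k * s)) \<le> 2 * weight (2 ^ k * s)" using assms by (intro weight_double) auto
      then have "(2 * (2 ^ k * s)) * weight (2 * (2 ^ k * s)) \<le> (2 * (2 ^ k * s)) * (2 * weight (2 ^ k * s))"
        using assms by (intro mult_left_mono) auto
      then show ?thesis by (simp add: \<phi>_def mult_ac)
    qed simp
    with Suc show ?case by (simp add: mult.assoc)
  qed simp
  define k where "k = nat \<lceil>log 2 t\<rceil>"
  have t1: "1 < t" using False by simp
  then have log: "0 \<le> log 2 t" by simp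
  have "t = 2 powr log 2 t" using t1 by simp
  also have "\<dots> \<le> 2 powr real k" unfolding k_def by (intro powr_mono) (use log in linarith, simp)
  finally have k1: "t \<le> 2 ^ k" by (simp add: powr_realpow)
  have "2 ^ k = 2 powr real k" by (simp add: powr_realpow)
  also have "\<dots> \<le> 2 powr (log 2 t + 1)" unfolding k_def by (intro powr_mono) (use log in linarith, simp)
  also have "\<dots> = 2 * t" using t1 by (simp add: powr_add)
  finally have k2: "2 ^ k \<le> 2 * t" .
  have "\<phi> (t * s) \<le> \<phi> (2 ^ k * s)" using k1 assms by (intro \<phi>_mono mult_right_mono) auto
  also have "\<dots> \<le> 4 ^ k * \<phi> s" by (rule pow)
  also have "(4 :: real) ^ k = (2 ^ k) ^ 2"
    using power_commutes power_mult[of "2 :: real" 2 k] power_mult[of "2 :: real" k 2] by (simp add: mult.commute)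
  also have "\<dots> * \<phi> s \<le> (2 * t) ^ 2 * \<phi> s" using k2 \<phi>_nonneg[of s] assms by (intro mult_right_mono power_mono) auto
  also have "\<dots> \<le> (t + 4 * t ^ 2) * \<phi> s" using \<phi>_nonneg[of s] assms by (intro mult_right_mono) auto
  finally show ?thesis .
qed

text \<open>A lower bound for \<phi> (r s) / \<phi> s that does not depend on s.\<close>
definition shrink :: "real \<Rightarrow> real" where "shrink r = 1 / (1 / r + 4 / r ^ 2)"

lemma shrink: "0 < r \<Longrightarrow> 0 < shrink r" "0 < r \<Longrightarrow> 0 \<le> s \<Longrightarrow> shrink r * \<phi> s \<le> \<phi> (r * s)"
proof -
  assume r: "0 < r"
  then show "0 < shrink r" by (simp add: shrink_def add_pos_pos)
  assume s: "0 \<le> s"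
  have "\<phi> s \<le> (1 / r + 4 / r ^ 2) * \<phi> (r * s)"
    using \<phi>_scale[of "1 / r" "r * s"] r s by (simp add: power_divide)
  moreover have "0 < 1 / r + 4 / r ^ 2" using r by (intro add_pos_pos) auto
  ultimately show "shrink r * \<phi> s \<le> \<phi> (r * s)"
    by (simp add: shrink_def divide_le_eq mult.commute)
qed

lemma weight_L: "weight (L n) = (1/2) ^ card {i \<in> big. i < n}"
  by (simp add: weight_def le_iff Suc_le_eq)

text \<open>
  The length of an interval of level n in the new Cantor set: the sum of the lengths of all the gaps
  in it, of which there are 2^k at level n + k. Since infinitely many steps are big, E is a null set
  and L n is likewise the sum of the lengths of the gaps in an interval of level n; here every gap is
  replaced by its image.
\<close>
definition L' :: "nat \<Rightarrow> real" where
  "L' n = (\<Sum>k. 2 ^ k * \<phi> (gap (n + k)))"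

lemma sum_gaps: "(\<Sum>k<K. 2 ^ k * gap (n + k)) = L n - 2 ^ K * L (n + K)"
  by (induction K) (auto simp: gap_def algebra_simps)

lemma gap_le: "gap n \<le> L n"
  using pos[of "Suc n"] by (simp add: gap_def)

lemma sum_image_gaps_le: "(\<Sum>k<K. 2 ^ k * \<phi> (gap (n + k))) \<le> \<phi> (L n)"
proof -
  have "(\<Sum>k<K. 2 ^ k * \<phi> (gap (n + k))) \<le> (\<Sum>k<K. 2 ^ k * (gap (n + k) * weight (L n)))"
    by (intro sum_mono mult_left_mono \<phi>_le_weight gap_nonneg order_trans[OF gap_le antimono]) auto
  also have "\<dots> = (\<Sum>k<K. 2 ^ k * gap (n + k)) * weight (L n)"
    by (simp add: sum_distrib_right mult.assoc)
  also have "\<dots> \<le> L n * weight (L n)"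
    unfolding sum_gaps using pos[of "n + K"] weight_pos[of "L n"] by (intro mult_right_mono) auto
  finally show ?thesis by (simp add: \<phi>_def)
qed

lemma image_gap_nonneg: "0 \<le> 2 ^ k * \<phi> (gap (n + k))"
  using \<phi>_nonneg gap_nonneg by simp

lemma summable_image_gaps: "summable (\<lambda>k. 2 ^ k * \<phi> (gap (n + k)))"
  by (rule summableI_nonneg_bounded[of _ "\<phi> (L n)"]) (auto intro: image_gap_nonneg sum_image_gaps_le)

lemma L'_le: "L' n \<le> \<phi> (L n)"
  unfolding L'_def by (intro suminf_le_const summable_image_gaps sum_image_gaps_le)

lemma L'_split: "L' n = (\<Sum>k<m. 2 ^ k * \<phi> (gap (n + k))) + 2 ^ m * L' (n + m)"
proof -
  have "L' n = (\<Sum>k. 2 ^ (k + m) * \<phi> (gap (n + (k + m)))) + (\<Sum>k<m. 2 ^ k * \<phi> (gap (n + k)))"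
    unfolding L'_def by (rule suminf_split_initial_segment[OF summable_image_gaps])
  also have "(\<lambda>k. 2 ^ (k + m) * \<phi> (gap (n + (k + m)))) = (\<lambda>k. 2 ^ m * (2 ^ k * \<phi> (gap (n + m + k))))"
    by (simp add: power_add add_ac mult_ac)
  also have "(\<Sum>k. 2 ^ m * (2 ^ k * \<phi> (gap (n + m + k)))) = 2 ^ m * L' (n + m)"
    unfolding L'_def by (rule suminf_mult[OF summable_image_gaps])
  finally show ?thesis by simp
qed

lemma L'_Suc: "L' n = \<phi> (gap n) + 2 * L' (Suc n)"
  using L'_split[of n 1] by simp

lemma L'_nonneg: "0 \<le> L' n"
  unfolding L'_def by (intro suminf_nonneg summable_image_gaps image_gap_nonneg)

text \<open>
  Let i be the first big step from n on. Between n and i the weight at the scale of intervals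
  does not change. A gap of a step in between is either at least as long as L (i+1), and keeps at
  least half of the weight, or it is shorter than L (i+1). The total length of the latter is at most
  that of the intervals of level i, and the images of the big gaps in those have at least a fixed
  proportion of this length times the weight.
\<close>
lemma L'_ge: "shrink \<delta> / 2 * \<phi> (L n) \<le> L' n"
proof -
  define i where "i = (LEAST i. n \<le> i \<and> i \<in> big)"
  have ex: "\<exists>i. n \<le> i \<and> i \<in> big" using ex_big by (auto simp: big_def)
  have i: "n \<le> i" "i \<in> big" unfolding i_def using LeastI_ex[OF ex] by simp_all
  have least: "j \<notin> big" if "n \<le> j" "j < i" for j
    using not_less_Least[of j "\<lambda>i. n \<le> i \<and> i \<in> big"] that unfolding i_def by blast
  define m where "m = i - n"
  have im: "n + m = i" using i by (simp add: m_def)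
  have "{j \<in> big. j < i} = {j \<in> big. j < n}" using i least by (metis (lifting) not_le order.strict_trans2)
  then have w: "weight (L i) = weight (L n)" by (simp add: weight_L)
  have "{j \<in> big. j < Suc i} = insert i {j \<in> big. j < i}" using i by auto
  then have w': "weight (L n) = 2 * weight (L (Suc i))" using w by (simp add: weight_L)
  have A: "0 < shrink \<delta>" "shrink \<delta> \<le> 1"
  proof -
    have "1 \<le> 1 / \<delta>" using \<delta> by simp
    then have "1 \<le> 1 / \<delta> + 4 / \<delta> ^ 2" using \<delta> by (smt (verit) divide_nonneg_nonneg zero_le_power2)
    then show "shrink \<delta> \<le> 1" by (simp add: shrink_def)
  qed (use shrink \<delta> in auto)
  have "\<phi> (\<delta> * L i) \<le> \<phi> (gap i)" using i pos[of i] \<delta> by (intro \<phi>_mono) (auto simp: big_def)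
  then have Li: "shrink \<delta> * \<phi> (L i) \<le> L' i"
    using shrink(2)[of \<delta> "L i"] L'_Suc[of i] L'_nonneg[of "Suc i"] \<delta> pos[of i] by linarith
  have gaps: "weight (L n) * gap j \<le> 2 * \<phi> (gap j) + weight (L n) * L (Suc i)" for j
  proof (cases "L (Suc i) \<le> gap j")
    case True
    then have "weight (L (Suc i)) \<le> weight (gap j)" using pos by (intro weight_mono) auto
    then have "weight (L n) * gap j \<le> (2 * weight (gap j)) * gap j" unfolding w' using gap_nonneg by (intro mult_right_mono) auto
    then show ?thesis using weight_pos[of "L n"] pos[of "Suc i"] by (simp add: \<phi>_def mult_ac add_increasing2)
  next
    case False
    then have "weight (L n) * gap j \<le> weight (L n) * L (Suc i)" using weight_pos[of "L n"] by (intro mult_left_mono) auto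
    then show ?thesis using \<phi>_nonneg[OF gap_nonneg[of j]] by linarith
  qed
  have "\<phi> (L n) = weight (L n) * ((\<Sum>k<m. 2 ^ k * gap (n + k)) + 2 ^ m * L i)"
    using sum_gaps[of n m] by (simp add: \<phi>_def im)
  also have "\<dots> = (\<Sum>k<m. 2 ^ k * (weight (L n) * gap (n + k))) + 2 ^ m * \<phi> (L i)"
    by (simp add: w[symmetric] \<phi>_def distrib_left sum_distrib_left mult_ac)
  also have "(\<Sum>k<m. 2 ^ k * (weight (L n) * gap (n + k))) \<le>
      (\<Sum>k<m. 2 ^ k * (2 * \<phi> (gap (n + k)) + weight (L n) * L (Suc i)))"
    by (intro sum_mono mult_left_mono gaps) auto
  also have "\<dots> = 2 * (\<Sum>k<m. 2 ^ k * \<phi> (gap (n + k))) + (\<Sum>k<m. 2 ^ k) * (weight (L n) * L (Suc i))"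
    by (simp add: sum.distrib distrib_left sum_distrib_left sum_distrib_right mult_ac)
  also have "(\<Sum>k<m. 2 ^ k) * (weight (L n) * L (Suc i)) \<le> 2 ^ m * \<phi> (L i)"
  proof -
    have "(\<Sum>k<m. 2 ^ k) \<le> (2 :: real) ^ m" by (induction m) auto
    moreover have "weight (L n) * L (Suc i) \<le> \<phi> (L i)"
      unfolding \<phi>_def w using less_Suc[of i] weight_pos[of "L n"] by (simp add: mult.commute mult_left_mono)
    ultimately show ?thesis using weight_pos[of "L n"] pos[of "Suc i"] by (intro mult_mono) auto
  qed
  finally have "\<phi> (L n) \<le> 2 * ((\<Sum>k<m. 2 ^ k * \<phi> (gap (n + k))) + 2 ^ m * \<phi> (L i))" by (simp add: mult.commute mult.left_commute)
  then have "shrink \<delta> / 2 * \<phi> (L n) \<le>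
      shrink \<delta> / 2 * (2 * ((\<Sum>k<m. 2 ^ k * \<phi> (gap (n + k))) + 2 ^ m * \<phi> (L i)))"
    using A by (intro mult_left_mono) auto
  also have "\<dots> = shrink \<delta> * ((\<Sum>k<m. 2 ^ k * \<phi> (gap (n + k))) + 2 ^ m * \<phi> (L i))"
    by simp
  also have "\<dots> = shrink \<delta> * (\<Sum>k<m. 2 ^ k * \<phi> (gap (n + k))) + 2 ^ m * (shrink \<delta> * \<phi> (L i))"
    by (simp add: algebra_simps)
  also have "\<dots> \<le> 1 * (\<Sum>k<m. 2 ^ k * \<phi> (gap (n + k))) + 2 ^ m * L' i"
    using A Li by (intro add_mono mult_right_mono mult_left_mono sum_nonneg image_gap_nonneg) auto
  also have "\<dots> = L' n" using L'_split[of n m] im by simp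
  finally show ?thesis .
qed

sublocale image: halving_sequence L'
proof
  show "0 < L' n" for n
    using L'_ge[of n] \<phi>_pos[OF pos[of n]] shrink(1)[OF \<delta>(1)] by (smt (verit) mult_pos_pos half_gt_zero)
  show "2 * L' (Suc n) \<le> L' n" for n
    using L'_Suc[of n] \<phi>_nonneg[OF gap_nonneg] by simp
qed

lemma image_gap: "image.gap n = \<phi> (gap n)"
  using L'_Suc[of n] by (simp add: image.gap_def)

text \<open>
  Compare the two expansions given by \<open>point_diff\<close>. Every interval and every gap that
  occurs in the expansion of D = d(x,y) has length at most D, so is multiplied by at most weight D: this
  is the upper bound. For the lower bound, either the separating gap is at least D/2, or the first
  interval that occurs has length comparable to D, because lengths drop at most by the factor \<kappa>
  from one level to the next.
\<close>
lemma image_distance: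
  obtains b where "0 < b"
    "\<And>\<sigma> \<tau>. \<bar>image.point \<sigma> - image.point \<tau>\<bar> \<le> \<phi> \<bar>point \<sigma> - point \<tau>\<bar>"
    "\<And>\<sigma> \<tau>. b * \<phi> \<bar>point \<sigma> - point \<tau>\<bar> \<le> \<bar>image.point \<sigma> - image.point \<tau>\<bar>"
proof -
  define b where "b = min (shrink (1/2)) (shrink \<delta> / 2 * shrink (\<kappa> / 4))"
  have b: "0 < b" using shrink(1) \<kappa> \<delta> by (simp add: b_def)
  have main: "0 \<le> point \<tau> - point \<sigma> \<and> 0 \<le> image.point \<tau> - image.point \<sigma> \<and>
     image.point \<tau> - image.point \<sigma> \<le> \<phi> (point \<tau> - point \<sigma>) \<and>
     b * \<phi> (point \<tau> - point \<sigma>) \<le> image.point \<tau> - image.point \<sigma>"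
    if diff: "\<And>i. i < n \<Longrightarrow> \<sigma> i = \<tau> i" "\<not> \<sigma> n" "\<tau> n" for \<sigma> \<tau> n
  proof -
    define e :: "nat \<Rightarrow> real" where "e k = of_bool (\<not> \<sigma> (k + Suc n)) + of_bool (\<tau> (k + Suc n))" for k
    have e: "0 \<le> e k" "e k \<le> 2" "e k \<noteq> 0 \<Longrightarrow> 1 \<le> e k" for k by (auto simp: e_def)
    define step where "step k = L (k + Suc n) - L (Suc k + Suc n)" for k
    define step' where "step' k = L' (k + Suc n) - L' (Suc k + Suc n)" for k
    define D where "D = point \<tau> - point \<sigma>"
    define D' where "D' = image.point \<tau> - image.point \<sigma>"
    have D: "D = gap n + (\<Sum>k. e k * step k)"
      unfolding D_def e_def step_def by (rule point_diff) (use diff in auto)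
    have D': "D' = \<phi> (gap n) + (\<Sum>k. e k * step' k)"
      unfolding D'_def e_def step'_def image_gap[symmetric] by (rule image.point_diff) (use diff in auto)
    have summ: "summable (\<lambda>k. e k * step k)" "summable (\<lambda>k. e k * step' k)"
      unfolding step_def step'_def using e by (intro weighted_summable image.weighted_summable; blast)+
    have step: "0 < step k" "0 < step' k" for k
      unfolding step_def step'_def using step_pos[of "k + Suc n"] image.step_pos[of "k + Suc n"] by simp_all
    have step_eq: "step k = L (Suc k + Suc n) + gap (k + Suc n)"
      "step' k = L' (Suc k + Suc n) + \<phi> (gap (k + Suc n))" for k
      using L'_Suc[of "k + Suc n"] by (simp_all add: step_def step'_def gap_def)
    have tail: "0 \<le> (\<Sum>k. e k * step k)" "0 \<le> (\<Sum>k. e k * step' k)"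
      using e step less_imp_le by (intro suminf_nonneg summ mult_nonneg_nonneg; blast)+
    have D0: "0 \<le> D" using D tail gap_nonneg[of n] by simp
    have D'0: "0 \<le> D'" using D' tail \<phi>_nonneg[OF gap_nonneg[of n]] by simp
    have step_le: "step k \<le> D" if "e k \<noteq> 0" for k
    proof -
      have "1 * step k \<le> e k * step k" using e(3)[OF that] step[of k] by (intro mult_right_mono) auto
      also have "\<dots> = (\<Sum>j\<in>{k}. e j * step j)" by simp
      also have "\<dots> \<le> (\<Sum>j. e j * step j)"
        using e step less_imp_le by (intro sum_le_suminf summ mult_nonneg_nonneg) (auto intro: less_imp_le)
      finally show ?thesis using D gap_nonneg[of n] by simp
    qed
    have "D' \<le> gap n * weight D + (\<Sum>k. weight D * (e k * step k))"
      unfolding D'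
    proof (intro add_mono suminf_le summ summable_mult)
      show "\<phi> (gap n) \<le> gap n * weight D"
        using D tail by (intro \<phi>_le_weight gap_nonneg) auto
      show "e k * step' k \<le> weight D * (e k * step k)" for k
      proof (cases "e k = 0")
        case False
        have "L' (Suc k + Suc n) \<le> \<phi> (L (Suc k + Suc n))" by (rule L'_le)
        also have "\<dots> \<le> L (Suc k + Suc n) * weight D"
          using step_le[OF False] pos[of "Suc k + Suc n"] gap_nonneg[of "k + Suc n"] unfolding step_eq
          by (intro \<phi>_le_weight) auto
        finally have "L' (Suc k + Suc n) \<le> L (Suc k + Suc n) * weight D" .
        moreover have "\<phi> (gap (k + Suc n)) \<le> gap (k + Suc n) * weight D"
          using step_le[OF False] pos[of "Suc k + Suc n"] gap_nonneg[of "k + Suc n"] unfolding step_eq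
          by (intro \<phi>_le_weight) auto
        ultimately have "step' k \<le> weight D * step k" unfolding step_eq by (simp add: algebra_simps)
        then have "e k * step' k \<le> e k * (weight D * step k)" using e by (intro mult_left_mono) auto
        then show ?thesis by (simp add: mult_ac)
      qed simp
    qed
    also have "\<dots> = (gap n + (\<Sum>k. e k * step k)) * weight D"
      by (subst suminf_mult[OF summ(1)]) (simp only: distrib_right mult.commute[of "weight D"])
    also have "\<dots> = \<phi> D" by (simp only: D[symmetric] \<phi>_def)
    finally have upper: "D' \<le> \<phi> D" .
    have "b * \<phi> D \<le> D'"
    proof (cases "D / 2 \<le> gap n")
      case True
      have "b * \<phi> D \<le> shrink (1/2) * \<phi> D" using \<phi>_nonneg[OF D0] by (intro mult_right_mono) (auto simp: b_def)
      also have "\<dots> \<le> \<phi> (1/2 * D)" using D0 by (intro shrink) auto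
      also have "\<dots> \<le> \<phi> (gap n)" using True D0 by (intro \<phi>_mono) auto
      also have "\<dots> \<le> D'" using D' tail by simp
      finally show ?thesis .
    next
      case False
      have "\<exists>k. e k \<noteq> 0"
      proof (rule ccontr)
        assume "\<not> ?thesis"
        then have "D = gap n" using D by simp
        then show False using False gap_nonneg[of n] by simp
      qed
      define m where "m = (LEAST k. e k \<noteq> 0)"
      have em: "e m \<noteq> 0" unfolding m_def by (rule LeastI_ex) fact
      have before: "e k = 0" if "k < m" for k using that not_less_Least unfolding m_def by blast
      have "(\<Sum>k. e k * step k) = (\<Sum>k. e (k + m) * step (k + m)) + (\<Sum>k<m. e k * step k)"
        by (rule suminf_split_initial_segment[OF summ(1)])
      also have "(\<Sum>k<m. e k * step k) = 0" using before by (intro sum.neutral) auto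
      also have "(\<Sum>k. e (k + m) * step (k + m)) \<le> 2 * L (m + Suc n)"
        using weighted_le[of "\<lambda>k. e (k + m)" 2 "m + Suc n"] e by (simp add: step_def add_ac)
      finally have "D \<le> gap n + 2 * L (m + Suc n)" using D by simp
      then have "D \<le> 4 * L (m + Suc n)" using False by simp
      then have "\<kappa> / 4 * D \<le> \<kappa> * L (m + Suc n)" using \<kappa>(1) by simp
      also have "\<dots> \<le> L (Suc m + Suc n)" using \<kappa>(2)[of "m + Suc n"] by simp
      finally have key: "\<kappa> / 4 * D \<le> L (Suc m + Suc n)" .
      have "b * \<phi> D \<le> shrink \<delta> / 2 * (shrink (\<kappa> / 4) * \<phi> D)"
        using \<phi>_nonneg[OF D0] unfolding mult.assoc[symmetric] by (intro mult_right_mono) (auto simp: b_def)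
      also have "\<dots> \<le> shrink \<delta> / 2 * \<phi> (\<kappa> / 4 * D)"
        using D0 \<kappa> shrink(1)[OF \<delta>(1)] by (intro mult_left_mono shrink) auto
      also have "\<dots> \<le> shrink \<delta> / 2 * \<phi> (L (Suc m + Suc n))"
        using D0 \<kappa>(1) shrink(1)[OF \<delta>(1)] key by (intro mult_left_mono \<phi>_mono) auto
      also have "\<dots> \<le> L' (Suc m + Suc n)" by (rule L'_ge)
      also have "\<dots> \<le> 1 * step' m" unfolding step_eq using \<phi>_nonneg[OF gap_nonneg] by simp
      also have "\<dots> \<le> e m * step' m" using e(3)[OF em] step[of m] by (intro mult_right_mono) auto
      also have "\<dots> = (\<Sum>j\<in>{m}. e j * step' j)" by simp
      also have "\<dots> \<le> (\<Sum>j. e j * step' j)"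
        using e step less_imp_le by (intro sum_le_suminf summ mult_nonneg_nonneg) (auto intro: less_imp_le)
      also have "\<dots> \<le> D'" using D' \<phi>_nonneg[OF gap_nonneg[of n]] by simp
      finally show ?thesis .
    qed
    with upper D0 D'0 show ?thesis by (simp add: D_def D'_def)
  qed
  have both: "\<bar>image.point \<sigma> - image.point \<tau>\<bar> \<le> \<phi> \<bar>point \<sigma> - point \<tau>\<bar> \<and>
      b * \<phi> \<bar>point \<sigma> - point \<tau>\<bar> \<le> \<bar>image.point \<sigma> - image.point \<tau>\<bar>" for \<sigma> \<tau>
  proof (cases "\<sigma> = \<tau>")
    case False
    then obtain k where "\<sigma> k \<noteq> \<tau> k" by auto
    then have "initial \<sigma> (Suc k) \<noteq> initial \<tau> (Suc k)" by (auto simp: initial_Suc)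
    then obtain n where n: "\<sigma> n \<noteq> \<tau> n" "\<And>i. i < n \<Longrightarrow> \<sigma> i = \<tau> i"
      by (rule ex_first_difference) blast
    show ?thesis
    proof (cases "\<sigma> n")
      case True
      then show ?thesis using main[of n \<tau> \<sigma>] n by auto
    next
      case False
      then show ?thesis using main[of n \<sigma> \<tau>] n by (auto simp: abs_minus_commute)
    qed
  qed simp
  with b that show ?thesis by blast
qed

end

section \<open>Lowering the dimension\<close>

text \<open>
  A distortion function of the shape provided by \<open>\<phi>_scale\<close>: linear for small ratios,
  quadratic for large ones.
\<close>
lemma homeomorphism_scaled_quadratic:
  fixes b :: real
  assumes "0 < b"
  shows "\<exists>\<theta>. homeomorphism {0..} {0..} (\<lambda>t. (t + 4 * t ^ 2) / b) \<theta>"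
proof -
  define \<theta> where "\<theta> u = (sqrt (1 + 16 * b * u) - 1) / 8" for u
  have "homeomorphism {0..} {0..} (\<lambda>t. (t + 4 * t ^ 2) / b) \<theta>"
  proof (rule homeomorphismI)
    show "continuous_on {0..} (\<lambda>t. (t + 4 * t ^ 2) / b)" using assms by (intro continuous_intros) auto
    show "continuous_on {0..} \<theta>" unfolding \<theta>_def by (intro continuous_intros) auto
    show "\<theta> ((t + 4 * t ^ 2) / b) = t" if "t \<in> {0..}" for t
    proof -
      have "1 + 16 * b * ((t + 4 * t ^ 2) / b) = (1 + 8 * t) ^ 2"
        using assms by (simp add: power2_eq_square algebra_simps add_divide_distrib)
      then show ?thesis using that by (simp add: \<theta>_def)
    qed
    show "(\<theta> u + 4 * \<theta> u ^ 2) / b = u" if "u \<in> {0..}" for u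
    proof -
      have "8 * \<theta> u + 1 = sqrt (1 + 16 * b * u)" by (simp add: \<theta>_def diff_divide_distrib)
      then have "(8 * \<theta> u + 1) ^ 2 = 1 + 16 * b * u" using that assms by simp
      then show ?thesis using assms by (simp add: power2_eq_square field_simps)
    qed
  qed (use assms in \<open>auto simp: \<theta>_def\<close>)
  then show ?thesis by blast
qed

context compression begin

lemma quasisymmetric_image:
  obtains h where "quasisymmetric (submetric euclidean_metric (range point)) euclidean_metric h"
    "h ` range point \<subseteq> range image.point"
proof -
  define h where "h x = image.point (SOME \<sigma>. point \<sigma> = x)" for x
  obtain b where b: "0 < b"
    and b_upper: "\<And>\<sigma> \<tau>. \<bar>image.point \<sigma> - image.point \<tau>\<bar> \<le> \<phi> \<bar>point \<sigma> - point \<tau>\<bar>"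
    and b_lower: "\<And>\<sigma> \<tau>. b * \<phi> \<bar>point \<sigma> - point \<tau>\<bar> \<le> \<bar>image.point \<sigma> - image.point \<tau>\<bar>"
    by (rule image_distance) blast
  have code: "point (SOME \<sigma>. point \<sigma> = x) = x" if "x \<in> range point" for x
    using that by (intro someI_ex[of "\<lambda>\<sigma>. point \<sigma> = x"]) auto
  have upper: "\<bar>h x - h y\<bar> \<le> \<phi> \<bar>x - y\<bar>" if "x \<in> range point" "y \<in> range point" for x y
    using b_upper[of "SOME \<sigma>. point \<sigma> = x" "SOME \<sigma>. point \<sigma> = y"] that by (simp add: h_def code)
  have lower: "b * \<phi> \<bar>x - y\<bar> \<le> \<bar>h x - h y\<bar>" if "x \<in> range point" "y \<in> range point" for x y
    using b_lower[of "SOME \<sigma>. point \<sigma> = x" "SOME \<sigma>. point \<sigma> = y"] that by (simp add: h_def code)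
  have hpos: "0 < \<bar>h x - h y\<bar>" if "x \<in> range point" "y \<in> range point" "x \<noteq> y" for x y
    using lower[of x y] that b \<phi>_pos[of "\<bar>x - y\<bar>"] by (smt (verit) mult_pos_pos)
  then have inj: "inj_on h (range point)" by (intro inj_onI) fastforce
  define g where "g = inv_into (range point) h"
  have gh: "g (h x) = x" if "x \<in> range point" for x
    unfolding g_def by (rule inv_into_f_f[OF inj that])
  have "continuous_on (range point) h"
    unfolding continuous_on_iff
  proof (intro ballI allI impI)
    fix x e :: real assume x: "x \<in> range point" and e: "0 < e"
    show "\<exists>d>0. \<forall>x'\<in>range point. dist x' x < d \<longrightarrow> dist (h x') (h x) < e"
    proof (intro exI[of _ e] conjI ballI impI e)
      fix x' assume "x' \<in> range point" "dist x' x < e"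
      then show "dist (h x') (h x) < e"
        using upper[of x' x] \<phi>_le[of "\<bar>x' - x\<bar>"] x by (simp add: dist_real_def)
    qed
  qed
  moreover have "continuous_on (h ` range point) g"
    unfolding continuous_on_iff
  proof (intro ballI allI impI)
    fix u e :: real assume u: "u \<in> h ` range point" and e: "0 < e"
    then obtain x where x: "x \<in> range point" "u = h x" by blast
    show "\<exists>d>0. \<forall>v\<in>h ` range point. dist v u < d \<longrightarrow> dist (g v) (g u) < e"
    proof (intro exI[of _ "b * \<phi> e"] conjI ballI impI)
      show "0 < b * \<phi> e" using b \<phi>_pos[OF e] by simp
      fix v assume "v \<in> h ` range point" and v: "dist v u < b * \<phi> e"
      then obtain y where y: "y \<in> range point" "v = h y" by blast
      have "\<not> e \<le> \<bar>y - x\<bar>"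
      proof
        assume "e \<le> \<bar>y - x\<bar>"
        then have "b * \<phi> e \<le> b * \<phi> \<bar>y - x\<bar>" using b e by (intro mult_left_mono \<phi>_mono) auto
        then show False using lower[OF y(1) x(1)] v x y by (simp add: dist_real_def)
      qed
      then show "dist (g v) (g u) < e" using x y by (simp add: gh dist_real_def)
    qed
  qed
  ultimately have "homeomorphic_maps (top_of_set (range point)) (top_of_set (h ` range point)) h g"
    unfolding homeomorphic_maps_def by (auto simp: continuous_map_subtopology_eu gh)
  then have "embedding_map (mtopology_of (submetric euclidean_metric (range point))) (mtopology_of euclidean_metric) h"
    unfolding embedding_map_def by (simp add: mtopology_of_submetric homeomorphic_maps_imp_map)
  moreover have "\<bar>h x - h y\<bar> / \<bar>h y - h z\<bar> \<le> (t + 4 * t ^ 2) / b"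
    if A: "x \<in> range point" "y \<in> range point" "z \<in> range point" "0 < t" "y \<noteq> z" "\<bar>x - y\<bar> / \<bar>y - z\<bar> \<le> t" for x y z t
  proof -
    have "\<bar>x - y\<bar> \<le> t * \<bar>y - z\<bar>" using A by (simp add: divide_le_eq)
    then have "\<phi> \<bar>x - y\<bar> \<le> \<phi> (t * \<bar>y - z\<bar>)" by (intro \<phi>_mono) auto
    also have "\<dots> \<le> (t + 4 * t ^ 2) * \<phi> \<bar>y - z\<bar>" using A by (intro \<phi>_scale) auto
    also have "\<dots> \<le> (t + 4 * t ^ 2) * (\<bar>h y - h z\<bar> / b)"
      using lower[of y z] A b by (intro mult_left_mono) (auto simp: field_simps)
    finally have "\<bar>h x - h y\<bar> \<le> (t + 4 * t ^ 2) / b * \<bar>h y - h z\<bar>" using upper[of x y] A by simp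
    then show ?thesis using hpos[of y z] A by (simp add: divide_le_eq)
  qed
  ultimately have "eta_quasisymmetric (\<lambda>t. (t + 4 * t ^ 2) / b) (submetric euclidean_metric (range point)) euclidean_metric h"
    unfolding eta_quasisymmetric_def by (simp add: dist_real_def)
  then have "quasisymmetric (submetric euclidean_metric (range point)) euclidean_metric h"
    unfolding quasisymmetric_def using homeomorphism_scaled_quadratic[OF b] by blast
  moreover have "h ` range point \<subseteq> range image.point" by (auto simp: h_def)
  ultimately show ?thesis by (rule that)
qed

end

context halving_sequence begin

text \<open>L n \<ge> \<kappa>^n, so 2^n (L n)^t stays above 1 as long as \<kappa>^t \<ge> 1/2.\<close>
lemma Hausdorff_dim_pos:
  assumes L0: "L 0 = 1" and \<kappa>: "0 < \<kappa>" "\<And>n. \<kappa> * L n \<le> L (Suc n)"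
  shows "0 < Hausdorff_dim (submetric euclidean_metric (range point))"
proof -
  have \<kappa>_half: "\<kappa> \<le> 1/2" using \<kappa>(2)[of 0] half[of 0] L0 by simp
  define s where "s = ln 2 / ln (1 / \<kappa>)"
  have ln: "0 < ln (1 / \<kappa>)" using \<kappa>(1) \<kappa>_half by (intro ln_gt_zero) (simp add: field_simps)
  have s: "0 < s" using ln by (simp add: s_def)
  have pow: "\<kappa> ^ n \<le> L n" for n
  proof (induction n)
    case (Suc n)
    have "\<kappa> * \<kappa> ^ n \<le> \<kappa> * L n" using \<kappa>(1) Suc by (intro mult_left_mono) auto
    with \<kappa>(2)[of n] show ?case by simp
  qed (simp add: L0)
  have "ennreal s \<le> Hausdorff_dim (submetric euclidean_metric (range point))"
  proof (rule Hausdorff_dim_greatest)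
    fix t :: real assume t: "0 < t" "Hausdorff_measure (submetric euclidean_metric (range point)) t = 0"
    obtain n where n: "2 ^ n * L n powr t < 1" using Hausdorff_measure_eq_0_imp_small[OF t, of 1] by auto
    have "s \<le> t"
    proof (rule ccontr)
      assume "\<not> s \<le> t"
      then have "t * ln (1 / \<kappa>) \<le> ln 2" using ln by (simp add: s_def field_simps)
      then have "real n * (t * ln (1 / \<kappa>)) \<le> real n * ln 2" by (intro mult_left_mono) auto
      then have "- (real n * ln 2) \<le> t * (real n * ln \<kappa>)" using \<kappa>(1) by (simp add: ln_div algebra_simps)
      then have "exp (- (real n * ln 2)) \<le> exp (t * (real n * ln \<kappa>))" by simp
      also have "\<dots> = (\<kappa> ^ n) powr t" using \<kappa>(1) by (simp add: powr_def ln_realpow)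
      also have "\<dots> \<le> L n powr t" using \<kappa>(1) pow t by (intro powr_mono2) auto
      also have "exp (- (real n * ln 2)) = 1 / 2 ^ n"
        by (simp add: exp_minus exp_of_nat_mult field_simps)
      finally show False using n by (simp add: field_simps)
    qed
    then show "ennreal s \<le> ennreal t" by (rule ennreal_leI)
  qed
  then show ?thesis using s by (metis ennreal_eq_0_iff le_zero_eq less_le_not_le not_gr_zero)
qed

text \<open>
  Fix t0 < 1 with vanishing t0-dimensional measure. If 2^n (L n)^t < 1 for some t \<le> t0, then the total
  length 2^n L n is at most e^(-\<alpha> n). Steps that are not big contribute at most half of this
  decay by the choice of \<delta>, and a big step contributes a factor of at least \<kappa>. So the number N n of
  big steps is at least a fixed multiple of n, and 2^(-N n) \<le> (L n)^\<beta>. Therefore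
  2^n (L' n)^(t/(1+\<beta>)) \<le> 2^n (L n)^t at these n, and t/(1+\<beta>) is an upper bound for the dimension
  of the image whenever t is one for E.
\<close>
lemma conformal_dim_less:
  assumes L0: "L 0 = 1" and up: "uniformly_perfect (submetric euclidean_metric (range point))"
    and dim: "Hausdorff_dim (submetric euclidean_metric (range point)) < 1"
  shows "conformal_dim (submetric euclidean_metric (range point)) <
    Hausdorff_dim (submetric euclidean_metric (range point))"
proof -
  let ?E = "submetric euclidean_metric (range point)"
  obtain \<kappa> where \<kappa>: "0 < \<kappa>" "\<And>n. \<kappa> * L n \<le> L (Suc n)"
    using uniformly_perfect_imp_ratio[OF L0 up] by blast
  have \<kappa>_half: "\<kappa> \<le> 1/2" using \<kappa>(2)[of 0] half[of 0] L0 by simp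
  define \<Lambda> where "\<Lambda> = ln (1 / \<kappa>)"
  have \<Lambda>: "0 < \<Lambda>" unfolding \<Lambda>_def using \<kappa>(1) \<kappa>_half by (intro ln_gt_zero) (simp add: field_simps)
  obtain t0 where t0: "0 < t0" "t0 < 1" "Hausdorff_measure ?E t0 = 0"
  proof -
    have "\<exists>s\<in>{s. 0 < s \<and> Hausdorff_measure ?E s = 0}. ennreal s < 1"
      using dim unfolding Hausdorff_dim_def by (simp only: INF_less_iff)
    then show ?thesis using that by auto
  qed
  define \<alpha> where "\<alpha> = ln 2 * (1 / t0 - 1)"
  have \<alpha>: "0 < \<alpha>" using t0 by (simp add: \<alpha>_def)
  define \<delta> where "\<delta> = 1 - exp (- \<alpha> / 2)"
  have \<delta>: "0 < \<delta>" "\<delta> < 1" using \<alpha> by (auto simp: \<delta>_def)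
  define B where "B = {i. \<delta> * L i \<le> gap i}"
  define N where "N n = card {i \<in> B. i < n}" for n
  have N_Suc: "N (Suc n) = (if n \<in> B then Suc (N n) else N n)" for n
  proof -
    have "{i \<in> B. i < Suc n} = (if n \<in> B then insert n {i \<in> B. i < n} else {i \<in> B. i < n})"
      by (auto simp: less_Suc_eq)
    then show ?thesis by (simp add: N_def)
  qed
  have few: "exp (- \<Lambda> * N n - \<alpha> / 2 * n) \<le> 2 ^ n * L n" for n
  proof (induction n)
    case (Suc n)
    have exp\<Lambda>: "exp (- \<Lambda>) = \<kappa>" using \<kappa>(1) by (simp add: \<Lambda>_def ln_div)
    have "exp (- \<Lambda> * N (Suc n) - \<alpha> / 2 * Suc n) =
        exp (- \<Lambda> * N n - \<alpha> / 2 * n) * exp (- \<Lambda> * of_bool (n \<in> B) - \<alpha> / 2)"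
      by (simp add: N_Suc exp_add[symmetric] algebra_simps add_divide_distrib)
    also have "\<dots> \<le> (2 ^ n * L n) * exp (- \<Lambda> * of_bool (n \<in> B) - \<alpha> / 2)"
      by (intro mult_right_mono Suc) auto
    also have "L n * exp (- \<Lambda> * of_bool (n \<in> B) - \<alpha> / 2) \<le> 2 * L (Suc n)"
    proof (cases "n \<in> B")
      case True
      have "exp (- \<Lambda> - \<alpha> / 2) \<le> exp (- \<Lambda>)" using \<alpha> by simp
      then have "L n * exp (- \<Lambda> - \<alpha> / 2) \<le> L n * \<kappa>" unfolding exp\<Lambda> using pos[of n] by (intro mult_left_mono) auto
      then show ?thesis using True \<kappa>(2)[of n] pos[of "Suc n"] by (simp add: mult.commute)
    next
      case False
      then have "L n * (1 - \<delta>) \<le> 2 * L (Suc n)" by (simp add: B_def gap_def algebra_simps)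
      then show ?thesis using False by (simp add: \<delta>_def)
    qed
    then have "(2 ^ n * L n) * exp (- \<Lambda> * of_bool (n \<in> B) - \<alpha> / 2) \<le> 2 ^ n * (2 * L (Suc n))"
      unfolding mult.assoc by (intro mult_left_mono) auto
    finally show ?case by (simp add: mult_ac)
  qed (simp add: L0 N_def)
  have many: "\<alpha> / (2 * \<Lambda>) * n \<le> N n" if t: "0 < t" "t \<le> t0" and n: "2 ^ n * L n powr t < 1" for t n
  proof -
    have "ln (2 ^ n * L n powr t) < ln 1" using n pos[of n] by (intro ln_less_cancel_iff[THEN iffD2]) auto
    then have "n * ln 2 + t * ln (L n) < 0" using pos[of n] by (simp add: ln_mult ln_realpow ln_powr)
    then have "ln (L n) < - (n * ln 2) / t" using t by (simp add: field_simps)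
    also have "\<dots> \<le> - (n * ln 2) / t0" using t by (simp add: divide_left_mono)
    finally have lnL: "ln (L n) < - (n * ln 2) / t0" .
    have "exp (- \<Lambda> * N n - \<alpha> / 2 * n) \<le> exp (n * ln 2 + ln (L n))"
      using few[of n] pos[of n] by (simp add: exp_add exp_of_nat_mult)
    then have "- \<Lambda> * N n - \<alpha> / 2 * n \<le> n * ln 2 + ln (L n)" by simp
    with lnL have "- \<Lambda> * N n - \<alpha> / 2 * n \<le> n * ln 2 - (n * ln 2) / t0" by simp
    also have "\<dots> = - \<alpha> * n" by (simp add: \<alpha>_def algebra_simps)
    finally have "\<alpha> / 2 * n \<le> \<Lambda> * N n" by simp
    then show ?thesis using \<Lambda> by (simp add: field_simps)
  qed
  have small: "\<exists>n\<ge>n0. 2 ^ n * L n powr t < a"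
    if t: "0 < t" "Hausdorff_measure ?E t = 0" and a: "0 < a" for t a n0
  proof -
    obtain n where n: "2 ^ n * L n powr t < min a (L n0 powr t)"
      using Hausdorff_measure_eq_0_imp_small[OF t, of "min a (L n0 powr t)"] a pos[of n0] by auto
    have "1 * L n powr t \<le> 2 ^ n * L n powr t" by (intro mult_right_mono) auto
    then have "L n powr t < L n0 powr t" using n by simp
    then have "L n < L n0" using t pos powr_mono2[of t "L n0" "L n"] by (meson less_eq_real_def linorder_not_le)
    then have "n0 \<le> n" by (simp add: less_iff)
    then show ?thesis using n by auto
  qed
  have "\<exists>i\<ge>n. \<delta> * L i \<le> gap i" for n
  proof (rule ccontr)
    assume "\<not> ?thesis"
    then have "B \<subseteq> {..<n}" by (auto simp: B_def not_le[symmetric])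
    then have N_le: "N k \<le> n" for k
      using card_mono[of "{..<n}" "{i \<in> B. i < k}"] by (auto simp: N_def)
    obtain n0 where n0: "real n < \<alpha> / (2 * \<Lambda>) * real n0"
      using reals_Archimedean3[of "\<alpha> / (2 * \<Lambda>)"] \<alpha> \<Lambda> by (auto simp: mult.commute)
    obtain k where k: "n0 \<le> k" "2 ^ k * L k powr t0 < 1" using small[OF t0(1,3), of 1] by auto
    have "\<alpha> / (2 * \<Lambda>) * real n0 \<le> \<alpha> / (2 * \<Lambda>) * real k" using k \<alpha> \<Lambda> by (intro mult_left_mono) auto
    also have "\<dots> \<le> N k" using many[OF t0(1) order_refl k(2)] .
    also have "\<dots> \<le> n" using N_le by simp
    finally show False using n0 by simp
  qed
  then interpret compression L \<kappa> \<delta>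
    using \<kappa> \<delta> by unfold_locales auto
  have big: "big = B" by (simp add: big_def B_def)
  \<comment> \<open>N n \<ge> \<alpha> n / (2 \<Lambda>) and L n \<ge> e^(-\<Lambda> n); this exponent makes 2^(-N n) \<le> (L n)^\<beta>.\<close>
  define \<beta> where "\<beta> = \<alpha> * ln 2 / (2 * \<Lambda> ^ 2)"
  have \<beta>: "0 < \<beta>" using \<alpha> \<Lambda> by (simp add: \<beta>_def)
  have L_ge: "- \<Lambda> * n \<le> ln (L n)" for n
  proof (induction n)
    case (Suc n)
    have "ln (\<kappa> * L n) \<le> ln (L (Suc n))" using \<kappa>(1) \<kappa>(2)[of n] pos by simp
    then show ?case using Suc \<kappa>(1) pos[of n] by (simp add: ln_mult \<Lambda>_def ln_div algebra_simps)
  qed (simp add: L0)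
  have L'_small: "L' n \<le> L n powr (1 + \<beta>)" if "0 < t" "t \<le> t0" "2 ^ n * L n powr t < 1" for t n
  proof -
    have "- (ln 2 * N n) \<le> - (ln 2 * (\<alpha> / (2 * \<Lambda>) * n))"
      using mult_left_mono[OF many[OF that], of "ln 2"] by simp
    also have "\<dots> = \<beta> * (- \<Lambda> * n)" using \<Lambda> by (simp add: \<beta>_def power2_eq_square)
    also have "\<dots> \<le> \<beta> * ln (L n)" using \<beta> L_ge by (intro mult_left_mono) auto
    finally have "exp (- ln 2 * N n) \<le> exp (\<beta> * ln (L n))" by simp
    then have "exp (- ln 2) ^ N n \<le> exp (\<beta> * ln (L n))" by (simp only: exp_of_nat2_mult)
    then have "(1/2) ^ N n \<le> L n powr \<beta>"
      using pos[of n] by (simp add: powr_def exp_minus)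
    then have "L n * (1/2) ^ N n \<le> L n * L n powr \<beta>" using pos[of n] by (intro mult_left_mono) auto
    also have "\<dots> = L n powr (1 + \<beta>)" using pos[of n] by (simp add: powr_add)
    finally have "L n * (1/2) ^ N n \<le> L n powr (1 + \<beta>)" .
    moreover have "L' n \<le> L n * (1/2) ^ N n"
      using L'_le[of n] by (simp add: \<phi>_def weight_L big N_def)
    ultimately show ?thesis by linarith
  qed
  obtain h where h: "quasisymmetric ?E euclidean_metric h" "h ` range point \<subseteq> range image.point"
    by (rule quasisymmetric_image)
  let ?Y = "submetric euclidean_metric (h ` mspace ?E)"
  have le: "Hausdorff_dim ?Y \<le> ennreal (t / (1 + \<beta>))"
    if t: "0 < t" "t \<le> t0" "Hausdorff_measure ?E t = 0" for t
  proof (rule Hausdorff_dim_le)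
    show "0 < t / (1 + \<beta>)" using t \<beta> by simp
    then show "Hausdorff_measure ?Y (t / (1 + \<beta>)) = 0"
    proof (rule image.Hausdorff_measure_eq_0_of_range[rotated 2])
      fix a :: real assume "0 < a"
      then obtain n where n: "2 ^ n * L n powr t < min a 1" using small[OF t(1,3), of "min a 1"] by auto
      have "L' n powr (t / (1 + \<beta>)) \<le> (L n powr (1 + \<beta>)) powr (t / (1 + \<beta>))"
        using L'_small[OF t(1,2), of n] n t \<beta> L'_nonneg[of n] by (intro powr_mono2) auto
      also have "\<dots> = L n powr t" using \<beta> by (simp add: powr_powr)
      finally have "2 ^ n * L' n powr (t / (1 + \<beta>)) \<le> 2 ^ n * L n powr t" by simp
      also have "\<dots> < a" using n by simp
      finally show "\<exists>n. 2 ^ n * L' n powr (t / (1 + \<beta>)) < a" by blast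
    qed (use h in \<open>auto simp: dist_real_def\<close>)
  qed
  have "ennreal (1 + \<beta>) * Hausdorff_dim ?Y \<le> Hausdorff_dim ?E"
  proof (rule Hausdorff_dim_greatest)
    fix t :: real assume t: "0 < t" "Hausdorff_measure ?E t = 0"
    define t' where "t' = min t t0"
    have t': "0 < t'" "t' \<le> t0" "t' \<le> t" "Hausdorff_measure ?E t' = 0"
      using t t0 by (auto simp: t'_def min_def)
    have "ennreal (1 + \<beta>) * Hausdorff_dim ?Y \<le> ennreal (1 + \<beta>) * ennreal (t' / (1 + \<beta>))"
      by (intro mult_left_mono le t') auto
    also have "\<dots> = ennreal ((1 + \<beta>) * (t' / (1 + \<beta>)))" using \<beta> t' by (intro ennreal_mult[symmetric]) auto
    also have "(1 + \<beta>) * (t' / (1 + \<beta>)) = t'" using \<beta> by simp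
    also have "\<dots> \<le> ennreal t" using t' by (intro ennreal_leI)
    finally show "ennreal (1 + \<beta>) * Hausdorff_dim ?Y \<le> ennreal t" .
  qed
  moreover have "conformal_dim ?E \<le> Hausdorff_dim ?Y"
    by (rule conformal_dim_le_Hausdorff_dim[OF h(1)])
  ultimately have *: "ennreal (1 + \<beta>) * conformal_dim ?E \<le> Hausdorff_dim ?E"
    by (meson mult_left_mono order_trans zero_le)
  show ?thesis
  proof (rule ccontr)
    assume "\<not> ?thesis"
    then have "ennreal (1 + \<beta>) * Hausdorff_dim ?E \<le> ennreal (1 + \<beta>) * conformal_dim ?E"
      by (intro mult_left_mono) auto
    with * have **: "ennreal (1 + \<beta>) * Hausdorff_dim ?E \<le> Hausdorff_dim ?E" by (rule order_trans[rotated])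
    obtain d where d: "Hausdorff_dim ?E = ennreal d" "0 \<le> d"
      using dim by (cases "Hausdorff_dim ?E") auto
    have "0 < d" using Hausdorff_dim_pos[OF L0 \<kappa>] d by simp
    moreover have "ennreal ((1 + \<beta>) * d) \<le> ennreal d"
      using ** d \<beta> ennreal_mult[of "1 + \<beta>" d] by simp
    then have "(1 + \<beta>) * d \<le> d" using d by (simp add: ennreal_le_iff)
    ultimately show False using \<beta> by (simp add: algebra_simps mult_le_0_iff)
  qed
qed

end

theorem corollary3p3:
  fixes E :: "real set"
  assumes "middle_interval_Cantor_set E"
  shows "(uniformly_perfect (submetric euclidean_metric E) \<longrightarrow>
            (conformally_minimal (submetric euclidean_metric E) \<longleftrightarrow>
             Hausdorff_dim (submetric euclidean_metric E) = 1)) \<and>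
         (Hausdorff_dim (submetric euclidean_metric E) = 1 \<longrightarrow>
            (\<forall>(X :: 'a metric) (Y :: 'b metric) \<iota> F f.
               uniformly_perfect X \<and>
               isometric_embedding (submetric euclidean_metric E) X \<iota> \<and>
               quasisymmetric X Y F \<and> (\<forall>x\<in>E. F (\<iota> x) = f x) \<longrightarrow>
               Hausdorff_dim (submetric Y (f ` E)) \<ge> 1))"
proof -
  obtain L where L: "halving_sequence L" "L 0 = 1" and E: "E = range (halving_sequence.point L)"
    using middle_interval_Cantor_set_eq_range[OF assms] .
  interpret halving_sequence L by fact
  let ?E = "submetric euclidean_metric (range point)"
  show ?thesis
    unfolding E
  proof (intro conjI impI allI)
    assume up: "uniformly_perfect ?E"
    show "conformally_minimal ?E \<longleftrightarrow> Hausdorff_dim ?E = 1"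
    proof
      assume "conformally_minimal ?E"
      then have "\<not> Hausdorff_dim ?E < 1"
        using conformal_dim_less[OF L(2) up] by (auto simp: conformally_minimal_def)
      then show "Hausdorff_dim ?E = 1"
        using Hausdorff_dim_le_1[OF L(2)] by simp
    next
      assume dim: "Hausdorff_dim ?E = 1"
      have iso: "isometric_embedding ?E ?E (\<lambda>x. x)" by (simp add: isometric_embedding_def)
      have "1 \<le> conformal_dim ?E"
        unfolding conformal_dim_def
      proof (rule INF_greatest, clarify)
        fix Y :: "real metric" and f assume "quasisymmetric ?E Y f"
        then have "1 \<le> Hausdorff_dim (submetric Y (f ` range point))"
          by (intro Hausdorff_dim_quasisymmetric_image_ge_1[OF L(2) dim up iso]) auto
        then show "1 \<le> Hausdorff_dim (submetric Y (f ` mspace ?E))" by simp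
      qed
      moreover have "conformal_dim ?E \<le> 1"
      proof -
        have "embedding_map (mtopology_of ?E) (mtopology_of euclidean_metric) (\<lambda>x. x)"
          using homeomorphic_map_id[of "top_of_set (range point)" "top_of_set (range point)"]
          by (simp add: embedding_map_def mtopology_of_submetric id_def)
        then have "eta_quasisymmetric (\<lambda>t. t) ?E euclidean_metric (\<lambda>x. x)"
          by (simp add: eta_quasisymmetric_def)
        moreover have "homeomorphism {0::real..} {0..} (\<lambda>t. t) (\<lambda>t. t)"
          by (intro homeomorphismI) auto
        ultimately have "quasisymmetric ?E euclidean_metric (\<lambda>x. x)"
          unfolding quasisymmetric_def by blast
        from conformal_dim_le_Hausdorff_dim[OF this] show ?thesis using dim by simp
      qed
      ultimately show "conformally_minimal ?E"
        unfolding conformally_minimal_def dim by simp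
    qed
  next
    fix X :: "'a metric" and Y :: "'b metric" and \<iota> F f
    assume dim: "Hausdorff_dim ?E = 1" and
      A: "uniformly_perfect X \<and> isometric_embedding ?E X \<iota> \<and> quasisymmetric X Y F \<and>
        (\<forall>x\<in>range point. F (\<iota> x) = f x)"
    show "1 \<le> Hausdorff_dim (submetric Y (f ` range point))"
      by (rule Hausdorff_dim_quasisymmetric_image_ge_1[OF L(2) dim, of X \<iota> Y F]) (use A in auto)
  qed
qed

end
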